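(* There exist countable discrete groups $G_1$ and $G_2$ such that $G_1\equiv G_2$ in the language of pure groups, but $(\ell^{1}(G_1),* )\not\equiv(\ell^{1}(G_2),* )$ as $\mathcal{L}_{\mathrm{cnv}}$-structures.
   Context: For a discrete group $G$, $(\ell^1(G),* )$ denotes the convolution algebra of $G$: the real Banach lattice $\ell^1(G)$ (functions $f:G\to\mathbb{R}$ with $\|f\|=\sum_{x}|f(x)|<\infty$, pointwise order) equipped with convolution $(f*g)(x)=\sum_{y\in G}f(y)g(y^{-1}x)$. It is regarded as a metric structure in continuous first-order logic in the language $\mathcal{L}_{\mathrm{cnv}}=\{+,0,\wedge,\vee,\|\cdot\|,*\}$ with metric $d(f,g)=\|f-g\|$; formally one works in the unit ball, treating $+,\wedge,\vee$ as maps from the unit ball to the ball of radius $2$ (or rescaling them by $1/2$). $\equiv$ between convolution algebras is elementary equivalence in continuous logic. The language of pure groups is $\mathcal{L}_{\mathrm{grp}}=\{\cdot\}$, and $\equiv$ between groups is classical elementary equivalence. *)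

theory Defs
  imports "HOL-Analysis.Analysis" "HOL-Algebra.Group"
begin

datatype grp_tm = GVar nat | GMult grp_tm grp_tm

datatype grp_fm =
    GEq grp_tm grp_tm
  | GNeg grp_fm
  | GConj grp_fm grp_fm
  | GExists nat grp_fm

primrec grp_tm_vars :: "grp_tm \<Rightarrow> nat set" where
  "grp_tm_vars (GVar n) = {n}"
| "grp_tm_vars (GMult s t) = grp_tm_vars s \<union> grp_tm_vars t"

primrec grp_fm_vars :: "grp_fm \<Rightarrow> nat set" where
  "grp_fm_vars (GEq s t) = grp_tm_vars s \<union> grp_tm_vars t"
| "grp_fm_vars (GNeg \<phi>) = grp_fm_vars \<phi>"
| "grp_fm_vars (GConj \<phi> \<psi>) = grp_fm_vars \<phi> \<union> grp_fm_vars \<psi>"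
| "grp_fm_vars (GExists n \<phi>) = grp_fm_vars \<phi> - {n}"

primrec grp_tm_val :: "('a, 'b) monoid_scheme \<Rightarrow> (nat \<Rightarrow> 'a) \<Rightarrow> grp_tm \<Rightarrow> 'a" where
  "grp_tm_val G e (GVar n) = e n"
| "grp_tm_val G e (GMult s t) = grp_tm_val G e s \<otimes>\<^bsub>G\<^esub> grp_tm_val G e t"

fun grp_sat :: "('a, 'b) monoid_scheme \<Rightarrow> (nat \<Rightarrow> 'a) \<Rightarrow> grp_fm \<Rightarrow> bool" where
  "grp_sat G e (GEq s t) \<longleftrightarrow> grp_tm_val G e s = grp_tm_val G e t"
| "grp_sat G e (GNeg \<phi>) \<longleftrightarrow> \<not> grp_sat G e \<phi>"
| "grp_sat G e (GConj \<phi> \<psi>) \<longleftrightarrow> grp_sat G e \<phi> \<and> grp_sat G e \<psi>"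
| "grp_sat G e (GExists n \<phi>) \<longleftrightarrow> (\<exists>a\<in>carrier G. grp_sat G (e(n := a)) \<phi>)"

definition grp_elem_equiv :: "('a, 'c) monoid_scheme \<Rightarrow> ('b, 'd) monoid_scheme \<Rightarrow> bool" where
  "grp_elem_equiv G H \<longleftrightarrow>
     (\<forall>\<phi>. grp_fm_vars \<phi> = {} \<longrightarrow>
       (\<forall>e e'. range e \<subseteq> carrier G \<and> range e' \<subseteq> carrier H \<longrightarrow>
          grp_sat G e \<phi> = grp_sat H e' \<phi>))"

datatype cnv_tm =
    CVar nat
  | CZero
  | CAdd cnv_tm cnv_tm
  | CMeet cnv_tm cnv_tm
  | CJoin cnv_tm cnv_tm
  | CConv cnv_tm cnv_tm

datatype cnv_fm =
    CNorm cnv_tm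
  | CDist cnv_tm cnv_tm
  | CConn "(nat \<Rightarrow> real) \<Rightarrow> real" "cnv_fm list"
  | CSup nat cnv_fm
  | CInf nat cnv_fm

text \<open>An n-ary connective is an arbitrary continuous function on real n-space, the latter
  being the product space of extensional functions on the set of naturals below n.\<close>

fun cnv_wf :: "cnv_fm \<Rightarrow> bool" where
  "cnv_wf (CNorm t) \<longleftrightarrow> True"
| "cnv_wf (CDist s t) \<longleftrightarrow> True"
| "cnv_wf (CConn u \<phi>s) \<longleftrightarrow>
     continuous_map (product_topology (\<lambda>_. euclidean) {..<length \<phi>s}) euclidean u \<and>
     (\<forall>\<phi>\<in>set \<phi>s. cnv_wf \<phi>)"
| "cnv_wf (CSup n \<phi>) \<longleftrightarrow> cnv_wf \<phi>"
| "cnv_wf (CInf n \<phi>) \<longleftrightarrow> cnv_wf \<phi>"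

primrec cnv_tm_vars :: "cnv_tm \<Rightarrow> nat set" where
  "cnv_tm_vars (CVar n) = {n}"
| "cnv_tm_vars CZero = {}"
| "cnv_tm_vars (CAdd s t) = cnv_tm_vars s \<union> cnv_tm_vars t"
| "cnv_tm_vars (CMeet s t) = cnv_tm_vars s \<union> cnv_tm_vars t"
| "cnv_tm_vars (CJoin s t) = cnv_tm_vars s \<union> cnv_tm_vars t"
| "cnv_tm_vars (CConv s t) = cnv_tm_vars s \<union> cnv_tm_vars t"

fun cnv_fm_vars :: "cnv_fm \<Rightarrow> nat set" where
  "cnv_fm_vars (CNorm t) = cnv_tm_vars t"
| "cnv_fm_vars (CDist s t) = cnv_tm_vars s \<union> cnv_tm_vars t"
| "cnv_fm_vars (CConn u \<phi>s) = (\<Union>\<phi>\<in>set \<phi>s. cnv_fm_vars \<phi>)"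
| "cnv_fm_vars (CSup n \<phi>) = cnv_fm_vars \<phi> - {n}"
| "cnv_fm_vars (CInf n \<phi>) = cnv_fm_vars \<phi> - {n}"

record 'm cnv_structure =
  cnv_univ :: "'m set"
  cnv_zero :: 'm
  cnv_add :: "'m \<Rightarrow> 'm \<Rightarrow> 'm"
  cnv_meet :: "'m \<Rightarrow> 'm \<Rightarrow> 'm"
  cnv_join :: "'m \<Rightarrow> 'm \<Rightarrow> 'm"
  cnv_conv :: "'m \<Rightarrow> 'm \<Rightarrow> 'm"
  cnv_norm :: "'m \<Rightarrow> real"
  cnv_dist :: "'m \<Rightarrow> 'm \<Rightarrow> real"

primrec cnv_tm_val :: "'m cnv_structure \<Rightarrow> (nat \<Rightarrow> 'm) \<Rightarrow> cnv_tm \<Rightarrow> 'm" where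
  "cnv_tm_val M e (CVar n) = e n"
| "cnv_tm_val M e CZero = cnv_zero M"
| "cnv_tm_val M e (CAdd s t) = cnv_add M (cnv_tm_val M e s) (cnv_tm_val M e t)"
| "cnv_tm_val M e (CMeet s t) = cnv_meet M (cnv_tm_val M e s) (cnv_tm_val M e t)"
| "cnv_tm_val M e (CJoin s t) = cnv_join M (cnv_tm_val M e s) (cnv_tm_val M e t)"
| "cnv_tm_val M e (CConv s t) = cnv_conv M (cnv_tm_val M e s) (cnv_tm_val M e t)"

fun cnv_val :: "'m cnv_structure \<Rightarrow> (nat \<Rightarrow> 'm) \<Rightarrow> cnv_fm \<Rightarrow> real" where
  "cnv_val M e (CNorm t) = cnv_norm M (cnv_tm_val M e t)"
| "cnv_val M e (CDist s t) = cnv_dist M (cnv_tm_val M e s) (cnv_tm_val M e t)"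
| "cnv_val M e (CConn u \<phi>s) = u (\<lambda>i\<in>{..<length \<phi>s}. map (cnv_val M e) \<phi>s ! i)"
| "cnv_val M e (CSup n \<phi>) = (SUP a\<in>cnv_univ M. cnv_val M (e(n := a)) \<phi>)"
| "cnv_val M e (CInf n \<phi>) = (INF a\<in>cnv_univ M. cnv_val M (e(n := a)) \<phi>)"

definition cnv_elem_equiv :: "'m cnv_structure \<Rightarrow> 'n cnv_structure \<Rightarrow> bool" where
  "cnv_elem_equiv M N \<longleftrightarrow>
     (\<forall>\<phi>. cnv_wf \<phi> \<and> cnv_fm_vars \<phi> = {} \<longrightarrow>
       (\<forall>e e'. range e \<subseteq> cnv_univ M \<and> range e' \<subseteq> cnv_univ N \<longrightarrow>
          cnv_val M e \<phi> = cnv_val N e' \<phi>))"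

text \<open>Functions on the group are total functions vanishing outside the carrier.\<close>

definition l1_space :: "('a, 'b) monoid_scheme \<Rightarrow> ('a \<Rightarrow> real) set" where
  "l1_space G = {f. (\<lambda>x. \<bar>f x\<bar>) summable_on carrier G \<and> (\<forall>x. x \<notin> carrier G \<longrightarrow> f x = 0)}"

definition l1_norm :: "('a, 'b) monoid_scheme \<Rightarrow> ('a \<Rightarrow> real) \<Rightarrow> real" where
  "l1_norm G f = (\<Sum>\<^sub>\<infinity>x\<in>carrier G. \<bar>f x\<bar>)"

definition l1_conv :: "('a, 'b) monoid_scheme \<Rightarrow> ('a \<Rightarrow> real) \<Rightarrow> ('a \<Rightarrow> real) \<Rightarrow> 'a \<Rightarrow> real" where
  "l1_conv G f g x =
     (if x \<in> carrier G
      then \<Sum>\<^sub>\<infinity>y\<in>carrier G. f y * g (inv\<^bsub>G\<^esub> y \<otimes>\<^bsub>G\<^esub> x)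
      else 0)"

text \<open>The universe is the closed unit ball. It is closed under convolution, while sum, meet and
  join map it into the ball of radius 2 and are therefore rescaled by 1/2.\<close>

definition l1_alg :: "('a, 'b) monoid_scheme \<Rightarrow> ('a \<Rightarrow> real) cnv_structure" where
  "l1_alg G =
     \<lparr>cnv_univ = {f \<in> l1_space G. l1_norm G f \<le> 1},
      cnv_zero = (\<lambda>_. 0),
      cnv_add = (\<lambda>f g x. (f x + g x) / 2),
      cnv_meet = (\<lambda>f g x. min (f x) (g x) / 2),
      cnv_join = (\<lambda>f g x. max (f x) (g x) / 2),
      cnv_conv = l1_conv G,
      cnv_norm = l1_norm G,
      cnv_dist = (\<lambda>f g. l1_norm G (\<lambda>x. f x - g x))\<rparr>"

end

theory Submission
  imports Defs "HOL-Computational_Algebra.Polynomial"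
begin

text \<open>
  Take \<open>G\<^sub>1 = \<Oplus>\<^sub>n \<rat>/\<int>\<close> and \<open>G\<^sub>2 = G\<^sub>1 \<times> \<rat>\<close>. Both are divisible and contain, for every \<open>g\<close>, elements of
  order \<open>g\<close> that are independent of any given finite set; an Ehrenfeucht-Fraisse argument that
  compares integer linear relations with bounded coefficients shows that they are elementarily
  equivalent.

  The convolution algebra sees whether an element has finite order, because an idempotent
  probability measure is the Haar measure of a finite subgroup. In the locally finite group
  \<open>G\<^sub>1\<close>, every probability measure \<open>f\<close> is almost supported on a finite subgroup, whose Haar
  measure \<open>p\<close> satisfies \<open>p * p = p\<close> and \<open>f * p \<approx> p\<close>. In \<open>G\<^sub>2\<close> this fails robustly for the point mass
  at an element \<open>a\<close> that is not killed by a homomorphism \<open>\<tau>\<close> to the reals: the Fourier transform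
  \<open>F t = \<Sum>x. p x * cis (t * \<tau> x)\<close> of an almost idempotent \<open>p\<close> only takes values close to \<open>0\<close> or
  \<open>1\<close>, starts at \<open>F 0 \<approx> 1\<close>, and almost invariance under \<open>a\<close> forces \<open>F (pi / \<tau> a) \<approx> 0\<close>, which
  contradicts the continuity of \<open>F\<close>.
\<close>

no_notation Infinite_Set_Sum.abs_summable_on (infix \<open>abs'_summable'_on\<close> 50)

section \<open>Elementary equivalence of flexible abelian groups\<close>

definition zmul :: "int \<Rightarrow> 'a::ab_group_add \<Rightarrow> 'a" where
  "zmul k x = (if 0 \<le> k then ((+) x ^^ nat k) 0 else - (((+) x ^^ nat (- k)) 0))"

lemma zmul_0 [simp]: "zmul 0 x = 0"
  by (simp add: zmul_def)

lemma zmul_minus: "zmul (- k) x = - zmul k x"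
  by (auto simp: zmul_def)

lemma zmul_succ: "zmul (k + 1) x = x + zmul k x"
proof (cases "0 \<le> k")
  case True
  then have "nat (k + 1) = Suc (nat k)" by simp
  then show ?thesis using True by (simp add: zmul_def)
next
  case False
  then obtain m where m: "k = - int (Suc m)"
    by (cases k rule: int_cases) auto
  show ?thesis unfolding m by (cases "m = 0") (auto simp: zmul_def nat_add_distrib)
qed

lemma zmul_pred: "zmul (k - 1) x = zmul k x - x"
  using zmul_succ[of "k - 1" x] by simp

lemma zmul_additive:
  assumes "\<And>x y. h (x + y) = h x + h y"
  shows "h (zmul k x) = zmul k (h x)"
proof -
  have h0: "h 0 = 0" using assms[of 0 0] by simp
  have hd: "h (u - v) = h u - h v" for u v using assms[of "u - v" v] by simp
  show ?thesis
    by (induction k rule: int_induct[where k = 0]) (simp_all add: h0 hd assms zmul_succ zmul_pred)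
qed

interpretation zmul: module "zmul :: int \<Rightarrow> 'a::ab_group_add \<Rightarrow> 'a"
proof
  fix a b :: int and x y :: 'a
  show "zmul a (x + y) = zmul a x + zmul a y"
    by (induction a rule: int_induct[where k = 0]) (simp_all add: zmul_succ zmul_pred)
  show add: "zmul (a + b) x = zmul a x + zmul b x" for a b
  proof (induction a rule: int_induct[where k = 0])
    case (step1 i)
    have "i + 1 + b = i + b + 1" by simp
    then show ?case using step1 by (metis zmul_succ add.assoc)
  next
    case (step2 i)
    have "i - 1 + b = i + b - 1" by simp
    then show ?case using step2 by (metis zmul_pred diff_add_eq)
  qed simp
  have diff: "zmul (a - b) x = zmul a x - zmul b x" for a b
    using add[of "a - b" b] by simp
  show "zmul a (zmul b x) = zmul (a * b) x"
    by (induction a rule: int_induct[where k = 0])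
      (simp_all add: zmul_succ zmul_pred add diff distrib_right left_diff_distrib)
  show "zmul 1 x = x"
    using zmul_succ[of 0 x] by simp
qed

lemma zmul_of_int: "zmul k (x::'a::ring_1) = of_int k * x"
  by (induction k rule: int_induct[where k = 0]) (simp_all add: zmul_succ zmul_pred algebra_simps)

text \<open>When \<open>0\<close> lies in \<open>F\<close>, the second condition gives an element
  \<open>u\<close> of order exactly \<open>g\<close> whose multiples avoid \<open>F\<close> apart
  from \<open>0\<close>. Adding such a \<open>u\<close> to a solution of \<open>g x = y\<close>
  yields a solution without accidental relations.\<close>

definition flexible :: "'a::ab_group_add itself \<Rightarrow> bool" where
  "flexible _ \<longleftrightarrow>
     (\<forall>g>0. \<forall>y::'a. \<exists>x. zmul g x = y) \<and>
     (\<forall>F::'a set. \<forall>g>0. finite F \<longrightarrow> (\<exists>u. zmul g u = 0 \<and> (\<forall>k. zmul k u \<in> F \<longrightarrow> g dvd k)))"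

section \<open>Integer linear relations with bounded coefficients\<close>

definition lincomb :: "nat set \<Rightarrow> (nat \<Rightarrow> int) \<Rightarrow> (nat \<Rightarrow> 'a::ab_group_add) \<Rightarrow> 'a" where
  "lincomb W c e = (\<Sum>i\<in>W. zmul (c i) (e i))"

text \<open>The positions of the back-and-forth argument. The bound \<open>N\<close> plays the role
  of the number of remaining rounds: it drops whenever a new element is chosen.\<close>

definition rel_equiv ::
    "int \<Rightarrow> nat set \<Rightarrow> (nat \<Rightarrow> 'a::ab_group_add) \<Rightarrow> (nat \<Rightarrow> 'b::ab_group_add) \<Rightarrow> bool" where
  "rel_equiv N W e e' \<longleftrightarrow>
     (\<forall>c. (\<forall>i\<in>W. \<bar>c i\<bar> \<le> N) \<longrightarrow> (lincomb W c e = 0 \<longleftrightarrow> lincomb W c e' = 0))"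

lemma rel_equiv_sym: "rel_equiv N W e e' \<Longrightarrow> rel_equiv N W e' e"
  by (auto simp: rel_equiv_def)

lemma lincomb_extend_zero:
  assumes "finite V" and "W \<subseteq> V"
  shows "lincomb V (\<lambda>i. if i \<in> W then c i else 0) f = lincomb W c f"
  unfolding lincomb_def using assms by (intro sum.mono_neutral_cong_right) auto

lemma rel_equiv_mono:
  assumes "rel_equiv M V e e'" and "N \<le> M" and "W \<subseteq> V" and "finite V" and "0 \<le> N"
  shows "rel_equiv N W e e'"
  unfolding rel_equiv_def
proof (intro allI impI)
  fix c assume c: "\<forall>i\<in>W. \<bar>c i\<bar> \<le> N"
  let ?c = "\<lambda>i. if i \<in> W then c i else 0"
  have "\<forall>i\<in>V. \<bar>?c i\<bar> \<le> M" using c assms(2,5) by fastforce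
  with assms(1)[unfolded rel_equiv_def, THEN spec[of _ ?c]]
  have "lincomb V ?c e = 0 \<longleftrightarrow> lincomb V ?c e' = 0" ..
  then show "lincomb W c e = 0 \<longleftrightarrow> lincomb W c e' = 0"
    by (simp only: lincomb_extend_zero[OF assms(4,3)])
qed

lemma lincomb_diff: "lincomb W (\<lambda>i. c i - d i) e = lincomb W c e - lincomb W d e"
  by (simp add: lincomb_def zmul.scale_left_diff_distrib sum_subtractf)

lemma lincomb_scale: "lincomb W (\<lambda>i. k * c i) e = zmul k (lincomb W c e)"
  by (simp add: lincomb_def zmul.scale_sum_right)

text \<open>Supplies the finite sets to which flexibility is applied. Only the restriction of
  \<open>c\<close> to \<open>W\<close> matters, and the restrictions form a finite product of
  intervals.\<close>

lemma finite_bounded_lincombs: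
  assumes "finite W"
  shows "finite {lincomb W c e |c. \<forall>i\<in>W. \<bar>c i\<bar> \<le> N}"
proof (rule finite_subset)
  show "{lincomb W c e |c. \<forall>i\<in>W. \<bar>c i\<bar> \<le> N} \<subseteq> (\<lambda>c. lincomb W c e) ` (PiE W (\<lambda>_. {-N..N}))"
  proof
    fix x assume "x \<in> {lincomb W c e |c. \<forall>i\<in>W. \<bar>c i\<bar> \<le> N}"
    then obtain c where c: "x = lincomb W c e" "\<forall>i\<in>W. \<bar>c i\<bar> \<le> N" by blast
    have "x = lincomb W (restrict c W) e" unfolding c lincomb_def by simp
    moreover have "restrict c W \<in> PiE W (\<lambda>_. {-N..N})" using c(2) by (auto simp: abs_le_iff)
    ultimately show "x \<in> (\<lambda>c. lincomb W c e) ` (PiE W (\<lambda>_. {-N..N}))" by blast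
  qed
  show "finite ((\<lambda>c. lincomb W c e) ` (PiE W (\<lambda>_. {-N..N})))"
    using assms by (intro finite_imageI finite_PiE) auto
qed

lemma lincomb_insert_eq_0_iff:
  assumes "finite W" and "n \<notin> W"
  shows "lincomb (insert n W) c (f(n := x)) = 0 \<longleftrightarrow> zmul (- c n) x = lincomb W c f"
proof -
  have "(\<Sum>i\<in>W. zmul (c i) ((f(n := x)) i)) = lincomb W c f"
    unfolding lincomb_def using assms(2) by (intro sum.cong) auto
  then have "lincomb (insert n W) c (f(n := x)) = zmul (c n) x + lincomb W c f"
    using assms by (simp add: lincomb_def)
  then show ?thesis by (auto simp: zmul_minus add_eq_0_iff)
qed

text \<open>A relation involving the new variable says that a bounded multiple of the new element is
  a bounded combination of the old ones, so it suffices to compare these equations.\<close>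

lemma rel_equiv_insertI:
  assumes "finite W" and "n \<notin> W"
    and "\<And>k c. \<bar>k\<bar> \<le> N \<Longrightarrow> \<forall>i\<in>W. \<bar>c i\<bar> \<le> N \<Longrightarrow>
           zmul k a = lincomb W c e \<longleftrightarrow> zmul k b = lincomb W c e'"
  shows "rel_equiv N (insert n W) (e(n := a)) (e'(n := b))"
  unfolding rel_equiv_def lincomb_insert_eq_0_iff[OF assms(1,2)]
  by (intro allI impI assms(3)) auto

text \<open>The bounds \<open>T j\<close> grow as \<open>j\<close> decreases, so that reducing a relation modulo the
  least \<open>g\<close> for which \<open>g a\<close> is a combination with coefficients at most \<open>T g\<close> yields a relation
  within the bound for the remainder. Hence \<open>g\<close> divides every multiple of \<open>a\<close> occurring in a
  relation with coefficients at most \<open>N\<close>.\<close>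

lemma rel_equiv_extend:
  fixes e :: "nat \<Rightarrow> 'a::ab_group_add" and e' :: "nat \<Rightarrow> 'b::ab_group_add" and a :: 'a
  assumes flex: "flexible TYPE('b)" and W: "finite W" "n \<notin> W"
    and R: "rel_equiv ((int N + 1) ^ (N + 1)) W e e'"
  shows "\<exists>b. rel_equiv (int N) (insert n W) (e(n := a)) (e'(n := b))"
proof -
  \<comment> \<open>\<open>T 0\<close> is the bound assumed in \<open>R\<close>. For indices up to
    \<open>N\<close>, each decrease gains a factor \<open>N + 1\<close>, room enough to subtract at
    most \<open>N\<close> times a relation bounded by \<open>T j\<close> from one bounded by
    \<open>N\<close>.\<close>
  define T :: "nat \<Rightarrow> int" where "T j = (int N + 1) ^ (N + 1 - j)" for j
  have T_anti: "T j \<le> T i" if "i \<le> j" for i j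
    unfolding T_def by (rule power_increasing) (use that in auto)
  have T_ge: "int N + 1 \<le> T j" if "j \<le> N" for j
    unfolding T_def using power_increasing[of 1 "N + 1 - j" "int N + 1"] that by simp
  have T_step: "int N + int N * T j \<le> T i" if "i < j" "j \<le> N" for i j
  proof -
    have "int N + int N * T j \<le> (int N + 1) * T j"
      using T_ge[OF that(2)] by (simp add: algebra_simps)
    also have "\<dots> = T (j - 1)"
    proof -
      have "N + 1 - (j - 1) = Suc (N + 1 - j)" using that by simp
      then show ?thesis unfolding T_def by (simp only: power_Suc)
    qed
    also have "\<dots> \<le> T i" by (rule T_anti) (use that in simp)
    finally show ?thesis .
  qed
  \<comment> \<open>Equality of two combinations is the vanishing of their difference, a relation
    within the bound \<open>T 0\<close>.\<close>
  have eqv: "lincomb W c e = lincomb W d e \<longleftrightarrow> lincomb W c e' = lincomb W d e'"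
    if "\<forall>i\<in>W. \<bar>c i - d i\<bar> \<le> T 0" for c d
  proof -
    have "lincomb W (\<lambda>i. c i - d i) e = 0 \<longleftrightarrow> lincomb W (\<lambda>i. c i - d i) e' = 0"
      using R that unfolding rel_equiv_def T_def by simp
    then show ?thesis by (simp add: lincomb_diff)
  qed
  define rep where "rep g \<beta> \<longleftrightarrow>
    0 < g \<and> g \<le> N \<and> (\<forall>i\<in>W. \<bar>\<beta> i\<bar> \<le> T g) \<and> zmul (int g) a = lincomb W \<beta> e" for g \<beta>
  show ?thesis
  proof (cases "\<exists>g \<beta>. rep g \<beta>")
    \<comment> \<open>Some small positive multiple of \<open>a\<close> is a bounded combination. The
      witness is \<open>d + u\<close>: \<open>d\<close> solves the corresponding equation for the
      least such \<open>g\<close>, and the torsion element \<open>u\<close> excludes relations whose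
      multiplier is not divisible by \<open>g\<close>.\<close>
    case True
    define g where "g = (LEAST g. \<exists>\<beta>. rep g \<beta>)"
    obtain \<beta> where "rep g \<beta>"
      using LeastI_ex[OF True] unfolding g_def by blast
    then have g: "0 < g" "g \<le> N" and \<beta>: "\<forall>i\<in>W. \<bar>\<beta> i\<bar> \<le> T g" "zmul (int g) a = lincomb W \<beta> e"
      unfolding rep_def by auto
    have quot: "\<bar>k div int g\<bar> \<le> int N" if "\<bar>k\<bar> \<le> int N" for k
    proof -
      define q where "q = k div int g"
      have q: "q * int g \<le> k" "k < (q + 1) * int g"
        using g pos_mod_bound[of "int g" k] pos_mod_sign[of "int g" k]
          div_mult_mod_eq[of k "int g"] unfolding q_def distrib_right by linarith+
      have "q \<le> int N"
      proof (rule ccontr)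
        assume "\<not> q \<le> int N"
        moreover from this have "q * 1 \<le> q * int g" using g by (intro mult_left_mono) auto
        ultimately show False using q(1) that by linarith
      qed
      moreover have "- int N \<le> q"
      proof (rule ccontr)
        assume "\<not> - int N \<le> q"
        then have *: "q + 1 \<le> - int N" by simp
        then have "(q + 1) * int g \<le> (q + 1) * 1"
          using g by (intro mult_left_mono_neg) auto
        then have "k < - int N" using * q(2) by simp
        then show False using that by simp
      qed
      ultimately show ?thesis unfolding q_def by simp
    qed
    have bound: "\<bar>c i - q * \<beta> i\<bar> \<le> int N + int N * T g"
      if "\<bar>q\<bar> \<le> int N" "\<bar>c i\<bar> \<le> int N" "i \<in> W" for q c i
    proof -
      have "\<bar>q * \<beta> i\<bar> \<le> int N * T g"
        unfolding abs_mult using that \<beta>(1) by (intro mult_mono) auto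
      then show ?thesis using that(2) abs_triangle_ineq4[of "c i" "q * \<beta> i"] by linarith
    qed
    have dvd: "int g dvd k" if k: "\<bar>k\<bar> \<le> int N" and c: "\<forall>i\<in>W. \<bar>c i\<bar> \<le> int N"
      and eq: "zmul k a = lincomb W c e" for k c
    proof (rule ccontr)
      assume "\<not> int g dvd k"
      define q r where "q = k div int g" and "r = nat (k mod int g)"
      have r: "0 < r" "r < g" "int r = k - q * int g"
        using g pos_mod_bound[of "int g" k] pos_mod_sign[of "int g" k] div_mult_mod_eq[of k "int g"]
          \<open>\<not> int g dvd k\<close>[unfolded dvd_eq_mod_eq_0]
        unfolding q_def r_def by linarith+
      have "zmul (int r) a = lincomb W c e - zmul q (lincomb W \<beta> e)"
        by (simp add: r zmul.scale_left_diff_distrib eq flip: \<beta>(2))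
      also have "\<dots> = lincomb W (\<lambda>i. c i - q * \<beta> i) e"
        by (simp add: lincomb_diff lincomb_scale)
      finally have "rep r (\<lambda>i. c i - q * \<beta> i)"
        unfolding rep_def using r g bound[OF quot[OF k]] c T_step[OF r(2) g(2)]
        by (force simp: q_def)
      then have "g \<le> r" unfolding g_def by (intro Least_le) blast
      then show False using r by simp
    qed
    obtain d where d: "zmul (int g) d = lincomb W \<beta> e'"
      using flex g unfolding flexible_def by (metis of_nat_0_less_iff)
    \<comment> \<open>The values that \<open>zmul k u\<close> would take if
      \<open>zmul k (d + u)\<close> were a bounded combination.\<close>
    define F where "F = (\<lambda>(x, k). x - zmul k d) `
      ({lincomb W c e' |c. \<forall>i\<in>W. \<bar>c i\<bar> \<le> int N} \<times> {- int N..int N})"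
    have "finite F" unfolding F_def using finite_bounded_lincombs[OF W(1)] by blast
    then obtain u where u: "zmul (int g) u = 0" "\<And>k. zmul k u \<in> F \<Longrightarrow> int g dvd k"
      using flex g unfolding flexible_def by (metis of_nat_0_less_iff)
    have dvd': "int g dvd k" if k: "\<bar>k\<bar> \<le> int N" and c: "\<forall>i\<in>W. \<bar>c i\<bar> \<le> int N"
      and eq: "zmul k (d + u) = lincomb W c e'" for k c
    proof (rule u(2))
      have "zmul k u = lincomb W c e' - zmul k d"
        using eq by (simp add: zmul.scale_right_distrib algebra_simps)
      then show "zmul k u \<in> F"
        unfolding F_def using k c by (force simp: abs_le_iff)
    qed
    \<comment> \<open>Once \<open>g\<close> divides \<open>k\<close>, both \<open>zmul k a\<close>
      and \<open>zmul k (d + u)\<close> equal \<open>q\<close> times the combination given by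
      \<open>\<beta>\<close>, and only old elements remain to be compared.\<close>
    have mult: "zmul k a = lincomb W c e \<longleftrightarrow> zmul k (d + u) = lincomb W c e'"
      if k: "\<bar>k\<bar> \<le> int N" and c: "\<forall>i\<in>W. \<bar>c i\<bar> \<le> int N" and "int g dvd k" for k c
    proof -
      obtain q where q: "k = q * int g" using \<open>int g dvd k\<close> by (metis dvdE mult.commute)
      have "q = k div int g" using q g by simp
      then have "\<bar>q\<bar> \<le> int N" using quot[OF k] by simp
      then have "\<forall>i\<in>W. \<bar>c i - q * \<beta> i\<bar> \<le> T 0"
        using bound[of q c] c T_step[of 0 g] g by fastforce
      note eqv[OF this]
      moreover have "zmul k a = lincomb W (\<lambda>i. q * \<beta> i) e"
        by (simp add: lincomb_scale q flip: \<beta>(2))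
      moreover have "zmul k (d + u) = lincomb W (\<lambda>i. q * \<beta> i) e'"
        by (simp add: lincomb_scale q zmul.scale_right_distrib u(1) flip: d zmul.scale_scale)
      ultimately show ?thesis by metis
    qed
    have "rel_equiv (int N) (insert n W) (e(n := a)) (e'(n := d + u))"
      by (rule rel_equiv_insertI[OF W]) (use dvd dvd' mult in blast)
    then show ?thesis ..
  next
    \<comment> \<open>No nonzero multiple of \<open>a\<close> within the bound is a bounded
      combination. An element \<open>u\<close> that meets \<open>F\<close> only at multiples
      divisible by \<open>N + 1\<close> behaves alike, because \<open>N + 1\<close> divides no
      nonzero \<open>k\<close> with \<open>|k| <= N\<close>.\<close>
    case False
    define F where "F = {lincomb W c e' |c. \<forall>i\<in>W. \<bar>c i\<bar> \<le> int N}"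
    have "finite F" unfolding F_def using finite_bounded_lincombs[OF W(1)] .
    then obtain u where u: "\<And>k. zmul k u \<in> F \<Longrightarrow> (int N + 1) dvd k"
      using flex unfolding flexible_def by (metis of_nat_0_less_iff of_nat_Suc zero_less_Suc add.commute)
    have "zmul k a = lincomb W c e \<longleftrightarrow> zmul k u = lincomb W c e'"
      if k: "\<bar>k\<bar> \<le> int N" and c: "\<forall>i\<in>W. \<bar>c i\<bar> \<le> int N" for k c
    proof (cases "k = 0")
      case True
      have "\<forall>i\<in>W. \<bar>0 - c i\<bar> \<le> T 0" using c T_ge[of 0] by fastforce
      from eqv[of "\<lambda>_. 0", OF this] show ?thesis using True by (simp add: lincomb_def)
    next
      case k0: False
      have "zmul k u \<noteq> lincomb W c e'"
      proof
        assume "zmul k u = lincomb W c e'"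
        then have "(int N + 1) dvd k" using u c unfolding F_def by blast
        then show False using k k0 by (auto dest: zdvd_imp_le[of _ "\<bar>k\<bar>", simplified])
      qed
      moreover have "zmul k a \<noteq> lincomb W c e"
      proof
        assume eq: "zmul k a = lincomb W c e"
        \<comment> \<open>\<open>rep\<close> asks for a positive multiplier, so the relation is
          multiplied by the sign of \<open>k\<close>.\<close>
        have "zmul \<bar>k\<bar> a = lincomb W (\<lambda>i. sgn k * c i) e"
          unfolding lincomb_scale eq[symmetric] by (simp add: abs_sgn mult.commute)
        moreover have "\<forall>i\<in>W. \<bar>sgn k * c i\<bar> \<le> T (nat \<bar>k\<bar>)"
          using c T_ge[of "nat \<bar>k\<bar>"] k k0 by (force simp: abs_mult nat_le_iff)
        ultimately have "rep (nat \<bar>k\<bar>) (\<lambda>i. sgn k * c i)"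
          unfolding rep_def using k k0 by (simp add: nat_le_iff)
        then show False using False by blast
      qed
      ultimately show ?thesis by blast
    qed
    then have "rel_equiv (int N) (insert n W) (e(n := a)) (e'(n := u))"
      by (rule rel_equiv_insertI[OF W])
    then show ?thesis ..
  qed
qed

section \<open>Group formulas in coded abelian groups\<close>

text \<open>Commutativity makes the value of a term depend only on how often each variable occurs in
  it.\<close>

primrec occurrences :: "grp_tm \<Rightarrow> nat \<Rightarrow> int" where
  "occurrences (GVar n) i = (if i = n then 1 else 0)"
| "occurrences (GMult s t) i = occurrences s i + occurrences t i"

text \<open>Links additive groups, which are types, to the carrier-based structures in which
  formulas are interpreted. In the end \<open>h\<close> takes values in the natural numbers.\<close>

definition additive_coding :: "('a::ab_group_add \<Rightarrow> 'c) \<Rightarrow> 'c monoid \<Rightarrow> bool" where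
  "additive_coding h G \<longleftrightarrow>
     inj h \<and> carrier G = range h \<and> (\<forall>x y. h x \<otimes>\<^bsub>G\<^esub> h y = h (x + y)) \<and> \<one>\<^bsub>G\<^esub> = h 0"

lemma grp_tm_val_coding:
  assumes "additive_coding h G" and "finite V" and "grp_tm_vars t \<subseteq> V"
  shows "grp_tm_val G (h \<circ> e) t = h (lincomb V (occurrences t) e)"
  using assms(3)
proof (induction t)
  case (GVar n)
  have "lincomb V (\<lambda>i. if i = n then 1 else 0) e = (\<Sum>i\<in>V. if i = n then e i else 0)"
    unfolding lincomb_def by (intro sum.cong) auto
  then show ?case using GVar assms(2) by simp
next
  case (GMult s t)
  then show ?case using assms(1)
    by (simp add: additive_coding_def lincomb_def zmul.scale_left_distrib sum.distrib)
qed

lemma grp_sat_exists_coding: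
  assumes "additive_coding h G"
  shows "grp_sat G (h \<circ> e) (GExists n \<phi>) \<longleftrightarrow> (\<exists>a. grp_sat G (h \<circ> e(n := a)) \<phi>)"
  using assms by (auto simp: additive_coding_def fun_upd_comp)

text \<open>Induction on the formula. An atomic formula is one linear relation, a conjunction takes
  the larger bound, and a quantifier is handled by \<open>rel_equiv_extend\<close> in both
  directions, at the cost of raising the bound from \<open>N\<close> to
  \<open>(N + 1) ^ (N + 1)\<close>.\<close>

lemma grp_sat_cong_rel_equiv:
  fixes h :: "'a::ab_group_add \<Rightarrow> 'c" and h' :: "'b::ab_group_add \<Rightarrow> 'd"
  assumes flex: "flexible TYPE('a)" "flexible TYPE('b)"
    and G: "additive_coding h G" and H: "additive_coding h' H"
  shows "finite V \<Longrightarrow> grp_fm_vars \<phi> \<subseteq> V \<Longrightarrow>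
    \<exists>N. \<forall>e e'. rel_equiv (int N) V e e' \<longrightarrow> grp_sat G (h \<circ> e) \<phi> = grp_sat H (h' \<circ> e') \<phi>"
proof (induction \<phi> arbitrary: V)
  case (GEq s t)
  define c where "c i = occurrences s i - occurrences t i" for i
  define N where "N = nat (\<Sum>i\<in>V. \<bar>c i\<bar>)"
  have c: "\<forall>i\<in>V. \<bar>c i\<bar> \<le> int N"
    unfolding N_def using GEq(1) by (auto intro!: member_le_sum simp: sum_nonneg)
  have "grp_sat G (h \<circ> e) (GEq s t) = grp_sat H (h' \<circ> e') (GEq s t)"
    if "rel_equiv (int N) V e e'" for e e'
  proof -
    have "grp_sat G (h \<circ> e) (GEq s t) \<longleftrightarrow> lincomb V c e = 0"
      using grp_tm_val_coding[OF G GEq(1)] GEq(2) G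
      by (auto simp: c_def[abs_def] lincomb_diff additive_coding_def inj_eq)
    moreover have "grp_sat H (h' \<circ> e') (GEq s t) \<longleftrightarrow> lincomb V c e' = 0"
      using grp_tm_val_coding[OF H GEq(1)] GEq(2) H
      by (auto simp: c_def[abs_def] lincomb_diff additive_coding_def inj_eq)
    ultimately show ?thesis using that c unfolding rel_equiv_def by blast
  qed
  then show ?case by blast
next
  case (GNeg \<phi>)
  then show ?case by simp
next
  case (GConj \<phi> \<psi>)
  then obtain M N where MN:
    "\<forall>e e'. rel_equiv (int M) V e e' \<longrightarrow> grp_sat G (h \<circ> e) \<phi> = grp_sat H (h' \<circ> e') \<phi>"
    "\<forall>e e'. rel_equiv (int N) V e e' \<longrightarrow> grp_sat G (h \<circ> e) \<psi> = grp_sat H (h' \<circ> e') \<psi>"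
    by (metis Un_subset_iff grp_fm_vars.simps(3))
  have "grp_sat G (h \<circ> e) (GConj \<phi> \<psi>) = grp_sat H (h' \<circ> e') (GConj \<phi> \<psi>)"
    if "rel_equiv (int (max M N)) V e e'" for e e'
  proof -
    have "rel_equiv (int M) V e e'" "rel_equiv (int N) V e e'"
      by (rule rel_equiv_mono[OF that _ order_refl GConj.prems(1)]; simp)+
    then show ?thesis using MN by simp
  qed
  then show ?case by blast
next
  case (GExists n \<phi>)
  \<comment> \<open>The quantifier overwrites the value of variable \<open>n\<close>, so relations
    involving its old value are dropped first.\<close>
  define W where "W = V - {n}"
  have W: "finite W" "n \<notin> W" "W \<subseteq> V" "grp_fm_vars \<phi> \<subseteq> insert n W"
    using GExists.prems by (auto simp: W_def)
  obtain N where N: "\<And>e e'. rel_equiv (int N) (insert n W) e e' \<Longrightarrow>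
      grp_sat G (h \<circ> e) \<phi> = grp_sat H (h' \<circ> e') \<phi>"
    using GExists.IH[OF _ W(4)] W(1) by blast
  have "grp_sat G (h \<circ> e) (GExists n \<phi>) = grp_sat H (h' \<circ> e') (GExists n \<phi>)"
    if "rel_equiv (int ((N + 1) ^ (N + 1))) V e e'" for e e'
  proof -
    have R: "rel_equiv ((int N + 1) ^ (N + 1)) W e e'"
      by (rule rel_equiv_mono[OF that _ W(3) GExists.prems(1)]) (simp_all add: algebra_simps)
    have "\<exists>b. rel_equiv (int N) (insert n W) (e(n := a)) (e'(n := b))" for a
      by (rule rel_equiv_extend[OF flex(2) W(1,2) R])
    moreover have "\<exists>a. rel_equiv (int N) (insert n W) (e(n := a)) (e'(n := b))" for b
      using rel_equiv_extend[OF flex(1) W(1,2) rel_equiv_sym[OF R]] rel_equiv_sym by blast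
    ultimately show ?thesis unfolding grp_sat_exists_coding[OF G] grp_sat_exists_coding[OF H] using N by blast
  qed
  then show ?case by blast
qed

text \<open>For a sentence the set of variables is empty, and the only linear relation is
  \<open>0 = 0\<close>.\<close>

lemma grp_elem_equiv_flexible:
  fixes h :: "'a::ab_group_add \<Rightarrow> 'c" and h' :: "'b::ab_group_add \<Rightarrow> 'd"
  assumes "flexible TYPE('a)" "flexible TYPE('b)"
    and G: "additive_coding h G" and H: "additive_coding h' H"
  shows "grp_elem_equiv G H"
  unfolding grp_elem_equiv_def
proof (intro allI impI)
  fix \<phi> and e :: "nat \<Rightarrow> 'c" and e' :: "nat \<Rightarrow> 'd"
  assume \<phi>: "grp_fm_vars \<phi> = {}" and "range e \<subseteq> carrier G \<and> range e' \<subseteq> carrier H"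
  then have e: "e = h \<circ> (inv_into UNIV h \<circ> e)" "e' = h' \<circ> (inv_into UNIV h' \<circ> e')"
    using G H by (auto simp: additive_coding_def fun_eq_iff f_inv_into_f subset_iff)
  obtain N where
    N: "\<And>e e'. rel_equiv (int N) {} e e' \<Longrightarrow> grp_sat G (h \<circ> e) \<phi> = grp_sat H (h' \<circ> e') \<phi>"
    using grp_sat_cong_rel_equiv[OF assms, of "{}" \<phi>] \<phi> by blast
  have "rel_equiv (int N) {} (inv_into UNIV h \<circ> e) (inv_into UNIV h' \<circ> e')"
    by (simp add: rel_equiv_def lincomb_def)
  from N[OF this] show "grp_sat G e \<phi> = grp_sat H e' \<phi>"
    unfolding e[symmetric] .
qed

section \<open>The groups\<close>

text \<open>The additive group of rational polynomials modulo integral ones is a direct sum of countably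
  many copies of \<open>\<rat>/\<int>\<close>, one for each coefficient.\<close>

quotient_type fracpoly = "rat poly" / "\<lambda>f g. \<forall>n. coeff f n - coeff g n \<in> \<int>"
proof (intro equivpI reflpI sympI transpI allI)
  fix f g h :: "rat poly" and n
  show "coeff f n - coeff f n \<in> \<int>" by simp
  assume fg: "\<forall>n. coeff f n - coeff g n \<in> \<int>"
  then show "coeff g n - coeff f n \<in> \<int>"
    using Ints_minus[of "coeff f n - coeff g n"] by simp
  assume "\<forall>n. coeff g n - coeff h n \<in> \<int>"
  with fg show "coeff f n - coeff h n \<in> \<int>"
    using Ints_add[of "coeff f n - coeff g n" "coeff g n - coeff h n"] by simp
qed

instantiation fracpoly :: ab_group_add
begin

lift_definition zero_fracpoly :: fracpoly is 0 .

lift_definition plus_fracpoly :: "fracpoly \<Rightarrow> fracpoly \<Rightarrow> fracpoly" is "(+)"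
  by (simp add: add_diff_add)

lift_definition uminus_fracpoly :: "fracpoly \<Rightarrow> fracpoly" is uminus
proof -
  fix f g :: "rat poly" and n
  assume "\<And>n. coeff f n - coeff g n \<in> \<int>"
  then show "coeff (- f) n - coeff (- g) n \<in> \<int>"
    using Ints_minus[of "coeff f n - coeff g n"] by simp
qed

definition minus_fracpoly :: "fracpoly \<Rightarrow> fracpoly \<Rightarrow> fracpoly" where
  "minus_fracpoly x y = x + - y"

instance
proof
  fix x y z :: fracpoly
  show "x + y + z = x + (y + z)" by transfer simp
  show "x + y = y + x" by transfer simp
  show "0 + x = x" by transfer simp
  show "- x + x = 0" by transfer simp
  show "x - y = x + - y" by (rule minus_fracpoly_def)
qed

end

lemma zmul_abs_fracpoly: "zmul k (abs_fracpoly f) = abs_fracpoly (smult (of_int k) f)"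
  by (simp add: zmul_of_int of_int_poly plus_fracpoly.abs_eq flip: zmul_additive[of abs_fracpoly])

lemma abs_fracpoly_eq_iff: "abs_fracpoly f = abs_fracpoly g \<longleftrightarrow> (\<forall>n. coeff f n - coeff g n \<in> \<int>)"
  by (simp add: fracpoly.abs_eq_iff)

lemma abs_fracpoly_exhaust: obtains f where "x = abs_fracpoly f"
  using Quotient3_abs_rep[OF Quotient3_fracpoly] by metis

text \<open>A polynomial has only finitely many nonzero coefficients, so some positive integer
  clears all their denominators.\<close>

lemma torsion_fracpoly: "\<exists>k>0. zmul k (x::fracpoly) = 0"
proof -
  obtain f where x: "x = abs_fracpoly f" by (rule abs_fracpoly_exhaust)
  have "\<exists>k>0::int. \<forall>n. of_int k * coeff f n \<in> \<int>"
  proof (induction f)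
    case 0
    show ?case by (intro exI[of _ 1]) simp
  next
    case (pCons c f)
    then obtain k where k: "k > 0" "\<And>n. of_int k * coeff f n \<in> \<int>" by blast
    obtain p q where q: "c = Rat.Fract p q" "q > 0" by (cases c) auto
    have "of_int q * c = of_int p" using q by (simp add: Fract_of_int_quotient)
    then have "of_int (k * q) * c \<in> \<int>" by (simp add: mult.assoc)
    moreover have "of_int (k * q) * coeff f n \<in> \<int>" for n
      using Ints_mult[OF Ints_of_int[of q] k(2)[of n]] by (simp add: ac_simps)
    ultimately show ?case using k q
      by (intro exI[of _ "k * q"]) (auto simp: coeff_pCons split: nat.split)
  qed
  then show ?thesis
    by (auto simp: x zmul_abs_fracpoly zero_fracpoly_def abs_fracpoly_eq_iff)
qed

text \<open>Division is coefficientwise. For the torsion witness, \<open>1 / g\<close> is placed at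
  a degree beyond the chosen representatives of \<open>F\<close>, so that a multiple lying in
  \<open>F\<close> must have an integral coefficient there.\<close>

lemma flexible_fracpoly: "flexible TYPE(fracpoly)"
  unfolding flexible_def
proof (intro conjI allI impI)
  fix g :: int and y :: fracpoly assume g: "0 < g"
  obtain f where "y = abs_fracpoly f" by (rule abs_fracpoly_exhaust)
  then have "zmul g (abs_fracpoly (smult (1 / of_int g) f)) = y"
    using g by (simp add: zmul_abs_fracpoly)
  then show "\<exists>x. zmul g x = y" ..
next
  fix F :: "fracpoly set" and g :: int assume g: "0 < g" and F: "finite F"
  define m where "m = Suc (Max (insert 0 (degree ` rep_fracpoly ` F)))"
  define u where "u = abs_fracpoly (monom (1 / of_int g) m)"
  have "zmul g u = 0"
    using g by (simp add: u_def zmul_abs_fracpoly zero_fracpoly_def abs_fracpoly_eq_iff coeff_monom)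
  moreover have "g dvd k" if "zmul k u \<in> F" for k
  proof -
    let ?f = "rep_fracpoly (zmul k u)"
    have "degree ?f < m" unfolding m_def less_Suc_eq_le using F that by (intro Max_ge) auto
    then have "coeff ?f m = 0" by (rule coeff_eq_0)
    moreover have "abs_fracpoly ?f = zmul k u"
      by (rule Quotient3_abs_rep[OF Quotient3_fracpoly])
    ultimately have "of_int k / of_int g \<in> (\<int> :: rat set)"
      unfolding u_def zmul_abs_fracpoly abs_fracpoly_eq_iff
      by (auto simp: coeff_monom dest!: spec[of _ m])
    then obtain q where "of_int k / of_int g = (of_int q :: rat)" by (auto elim: Ints_cases)
    then have "(of_int k :: rat) = of_int (q * g)" using g by (simp add: field_simps)
    then have "k = q * g" by (simp only: of_int_eq_iff)
    then show ?thesis by simp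
  qed
  ultimately show "\<exists>u. zmul g u = 0 \<and> (\<forall>k. zmul k u \<in> F \<longrightarrow> g dvd k)" by blast
qed

lemma zmul_Pair: "zmul k (x, y) = (zmul k x, zmul k y)"
  using zmul_additive[of fst k "(x, y)"] zmul_additive[of snd k "(x, y)"]
  by (simp add: prod_eq_iff)

text \<open>The factor \<open>rat\<close> is divisible, and the torsion witness can be taken in the
  first factor.\<close>

lemma flexible_prod_rat:
  assumes "flexible TYPE('a::ab_group_add)"
  shows "flexible TYPE('a \<times> rat)"
  unfolding flexible_def
proof (intro conjI allI impI)
  fix g :: int and y :: "'a \<times> rat" assume g: "0 < g"
  then obtain x where "zmul g x = fst y" using assms unfolding flexible_def by blast
  then have "zmul g (x, snd y / of_int g) = y"
    using g by (simp add: zmul_Pair zmul_of_int prod_eq_iff)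
  then show "\<exists>x. zmul g x = y" ..
next
  fix F :: "('a \<times> rat) set" and g :: int assume g: "0 < g" and F: "finite F"
  then obtain u where u: "zmul g u = 0" "\<And>k. zmul k u \<in> fst ` F \<Longrightarrow> g dvd k"
    using assms unfolding flexible_def by (meson finite_imageI)
  have "zmul g (u, 0::rat) = 0" using u(1) by (simp add: zmul_Pair zero_prod_def)
  moreover have "g dvd k" if "zmul k (u, 0::rat) \<in> F" for k
    using that u(2)[of k] by (force simp: zmul_Pair)
  ultimately show "\<exists>u. zmul g u = 0 \<and> (\<forall>k. zmul k u \<in> F \<longrightarrow> g dvd k)" by blast
qed

section \<open>Local finiteness of torsion groups and codings into the natural numbers\<close>

lemma finite_multiples:
  assumes "k > 0" and "zmul k x = 0"
  shows "finite (range (\<lambda>j. zmul j x))"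
proof (rule finite_subset)
  show "range (\<lambda>j. zmul j x) \<subseteq> (\<lambda>j. zmul j x) ` {0..<k}"
  proof safe
    fix j
    have "zmul j x = zmul (j div k) (zmul k x) + zmul (j mod k) x"
      by (simp flip: zmul.scale_left_distrib)
    then have "zmul j x = zmul (j mod k) x" using assms(2) by simp
    then show "zmul j x \<in> (\<lambda>j. zmul j x) ` {0..<k}" using assms(1) by auto
  qed
qed simp

text \<open>Adjoining an element of finite order to a finite subgroup \<open>H\<close> gives the
  sums of elements of \<open>H\<close> and multiples of that element, again a finite set closed
  under differences.\<close>

lemma torsion_imp_locally_finite:
  fixes S :: "'a::ab_group_add set"
  assumes torsion: "\<And>x::'a. \<exists>k>0. zmul k x = 0" and "finite S"
  shows "\<exists>H. finite H \<and> S \<subseteq> H \<and> 0 \<in> H \<and> (\<forall>x\<in>H. \<forall>y\<in>H. x - y \<in> H)"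
  using assms(2)
proof (induction S)
  case empty
  show ?case by (intro exI[of _ "{0}"]) simp
next
  case (insert x S)
  then obtain H where H: "finite H" "S \<subseteq> H" "0 \<in> H" "\<And>x y. x \<in> H \<Longrightarrow> y \<in> H \<Longrightarrow> x - y \<in> H" by blast
  obtain k where "k > 0" "zmul k x = 0" using torsion by blast
  note fin = finite_multiples[OF this]
  define K where "K = (\<lambda>(y, z). y + z) ` (H \<times> range (\<lambda>j. zmul j x))"
  have K: "y + zmul j x \<in> K" if "y \<in> H" for y j
    unfolding K_def using that by force
  have "x \<in> K" using K[of 0 1] H by simp
  moreover have "y \<in> K" if "y \<in> H" for y using K[OF that, of 0] by simp
  moreover have "y - z \<in> K" if yz: "y \<in> K" "z \<in> K" for y z
  proof -
    obtain y' i where y: "y = y' + zmul i x" "y' \<in> H" using yz(1) by (auto simp: K_def)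
    obtain z' j where z: "z = z' + zmul j x" "z' \<in> H" using yz(2) by (auto simp: K_def)
    have "y - z = (y' - z') + zmul (i - j) x"
      by (simp add: y z zmul.scale_left_diff_distrib)
    then show ?thesis using K[OF H(4)[OF y(2) z(2)]] by simp
  qed
  moreover have "finite K" unfolding K_def using H(1) fin by blast
  ultimately show ?case using H(2,3) by (intro exI[of _ K]) auto
qed

lemma ex_additive_coding:
  assumes "countable (UNIV :: 'a::ab_group_add set)"
  shows "\<exists>(h :: 'a \<Rightarrow> nat) G. additive_coding h G"
proof -
  obtain h :: "'a \<Rightarrow> nat" where h: "inj h" using assms by (auto simp: countable_def)
  let ?r = "inv_into UNIV h"
  have "additive_coding h \<lparr>carrier = range h, mult = (\<lambda>m n. h (?r m + ?r n)), one = h 0\<rparr>"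
    using h by (simp add: additive_coding_def inv_f_f)
  then show ?thesis by blast
qed

lemma additive_coding_comm_group:
  assumes "additive_coding h G"
  shows "comm_group G"
proof (rule comm_groupI)
  fix a assume "a \<in> carrier G"
  then obtain x where "a = h x" using assms by (auto simp: additive_coding_def)
  then have "h (- x) \<otimes>\<^bsub>G\<^esub> a = \<one>\<^bsub>G\<^esub>" "h (- x) \<in> carrier G"
    using assms by (auto simp: additive_coding_def)
  then show "\<exists>b\<in>carrier G. b \<otimes>\<^bsub>G\<^esub> a = \<one>\<^bsub>G\<^esub>" by blast
qed (use assms in \<open>auto simp: additive_coding_def ac_simps\<close>)

lemma additive_coding_subgroup:
  assumes G: "additive_coding h G" and H: "0 \<in> H" "\<And>x y. x \<in> H \<Longrightarrow> y \<in> H \<Longrightarrow> x - y \<in> H"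
  shows "subgroup (h ` H) G"
proof -
  interpret comm_group G using G by (rule additive_coding_comm_group)
  have neg: "- x \<in> H" if "x \<in> H" for x using H(2)[OF H(1) that] by simp
  have inv: "inv\<^bsub>G\<^esub> (h x) = h (- x)" for x
    using G by (intro inv_equality) (auto simp: additive_coding_def)
  show ?thesis
  proof (rule subgroupI)
    fix a b assume "a \<in> h ` H" "b \<in> h ` H"
    then obtain x y where "a = h x" "b = h y" "x \<in> H" "y \<in> H" by blast
    then show "a \<otimes>\<^bsub>G\<^esub> b \<in> h ` H" 
      using G H(2)[OF _ neg, of x y] by (auto simp: additive_coding_def)
  qed (use G H(1) neg inv in \<open>auto simp: additive_coding_def\<close>)
qed

lemma countable_fracpoly: "countable (UNIV :: fracpoly set)"
proof -
  have "countable (UNIV :: rat poly set)"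
    by (rule countableI'[of "\<lambda>f. to_nat (coeffs f)"]) (auto simp: inj_on_def coeffs_eq_iff)
  then have "countable (range abs_fracpoly)" by (rule countable_image)
  moreover have "range abs_fracpoly = UNIV" using abs_fracpoly_exhaust by blast
  ultimately show ?thesis by simp
qed

section \<open>Convolution and Fourier transform\<close>

text \<open>\<open>\<psi>\<close> is left arbitrary: the constant \<open>1\<close> recovers the
  total mass, and \<open>cis (t * \<tau> x)\<close> gives the Fourier transform along a real
  homomorphism.\<close>

definition l1_ft :: "('a, 'b) monoid_scheme \<Rightarrow> ('a \<Rightarrow> complex) \<Rightarrow> ('a \<Rightarrow> real) \<Rightarrow> complex" where
  "l1_ft G \<psi> f = (\<Sum>\<^sub>\<infinity>x\<in>carrier G. of_real (f x) * \<psi> x)"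

lemma l1_spaceD: "f \<in> l1_space G \<Longrightarrow> (\<lambda>x. \<bar>f x\<bar>) summable_on carrier G"
  by (simp add: l1_space_def)

lemma l1_ft_abs_summable:
  assumes "f \<in> l1_space G" and "\<And>x. x \<in> carrier G \<Longrightarrow> norm (\<psi> x) \<le> 1"
  shows "(\<lambda>x. complex_of_real (f x) * \<psi> x) abs_summable_on carrier G"
proof (rule summable_on_comparison_test[OF l1_spaceD[OF assms(1)]])
  fix x assume "x \<in> carrier G"
  then show "norm (complex_of_real (f x) * \<psi> x) \<le> \<bar>f x\<bar>"
    using mult_left_mono[OF assms(2), of x "\<bar>f x\<bar>"] by (simp add: norm_mult)
qed simp

lemma norm_l1_ft_le:
  assumes "f \<in> l1_space G" and "\<And>x. x \<in> carrier G \<Longrightarrow> norm (\<psi> x) \<le> 1"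
  shows "norm (l1_ft G \<psi> f) \<le> l1_norm G f"
proof -
  have "norm (l1_ft G \<psi> f) \<le> (\<Sum>\<^sub>\<infinity>x\<in>carrier G. norm (complex_of_real (f x) * \<psi> x))"
    unfolding l1_ft_def by (rule norm_infsum_bound[OF l1_ft_abs_summable[OF assms]])
  also have "\<dots> \<le> l1_norm G f"
    unfolding l1_norm_def
  proof (rule infsum_mono[OF l1_ft_abs_summable[OF assms] l1_spaceD[OF assms(1)]])
    fix x assume "x \<in> carrier G"
    then show "norm (complex_of_real (f x) * \<psi> x) \<le> \<bar>f x\<bar>"
      using mult_left_mono[OF assms(2), of x "\<bar>f x\<bar>"] by (simp add: norm_mult)
  qed
  finally show ?thesis .
qed

lemma l1_space_diff:
  assumes "f \<in> l1_space G" and "g \<in> l1_space G"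
  shows "(\<lambda>x. f x - g x) \<in> l1_space G"
proof -
  have "(\<lambda>x. \<bar>f x - g x\<bar>) summable_on carrier G"
    by (rule summable_on_comparison_test[OF summable_on_add[OF assms[THEN l1_spaceD]]]) auto
  then show ?thesis using assms by (simp add: l1_space_def)
qed

lemma l1_space_cmult:
  assumes "f \<in> l1_space G"
  shows "(\<lambda>x. c * f x) \<in> l1_space G"
proof -
  have "(\<lambda>x. \<bar>c * f x\<bar>) summable_on carrier G"
    unfolding abs_mult by (intro summable_on_cmult_right l1_spaceD[OF assms])
  moreover have "\<forall>x. x \<notin> carrier G \<longrightarrow> c * f x = 0"
    using assms by (simp add: l1_space_def)
  ultimately show ?thesis unfolding l1_space_def by blast
qed

lemma l1_ft_diff:
  assumes "f \<in> l1_space G" and "g \<in> l1_space G" and "\<And>x. x \<in> carrier G \<Longrightarrow> norm (\<psi> x) \<le> 1"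
  shows "l1_ft G \<psi> (\<lambda>x. f x - g x) = l1_ft G \<psi> f - l1_ft G \<psi> g"
proof -
  let ?F = "\<lambda>f x. complex_of_real (f x) * \<psi> x"
  have f: "(?F f has_sum l1_ft G \<psi> f) (carrier G)"
    unfolding l1_ft_def
    by (rule has_sum_infsum[OF abs_summable_summable[OF l1_ft_abs_summable[OF assms(1,3)]]])
  have g: "(?F g has_sum l1_ft G \<psi> g) (carrier G)"
    unfolding l1_ft_def
    by (rule has_sum_infsum[OF abs_summable_summable[OF l1_ft_abs_summable[OF assms(2,3)]]])
  have "((\<lambda>x. ?F f x + - ?F g x) has_sum (l1_ft G \<psi> f + - l1_ft G \<psi> g)) (carrier G)"
    by (rule has_sum_add[OF f has_sum_uminus[THEN iffD2]]) (simp add: g)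
  also have "(\<lambda>x. ?F f x + - ?F g x) = ?F (\<lambda>x. f x - g x)"
    by (simp add: fun_eq_iff left_diff_distrib)
  finally show ?thesis
    unfolding l1_ft_def[of G \<psi> "\<lambda>x. f x - g x"] by (simp add: infsumI)
qed

lemma l1_ft_cmult: "l1_ft G \<psi> (\<lambda>x. c * f x) = of_real c * l1_ft G \<psi> f"
  by (simp add: l1_ft_def mult.assoc infsum_cmult_right')

lemma has_sum_l1_norm:
  assumes "f \<in> l1_space G" and "\<And>x. 0 \<le> f x"
  shows "(f has_sum l1_norm G f) (carrier G)"
  using has_sum_infsum[OF l1_spaceD[OF assms(1)]] assms(2) by (simp add: l1_norm_def)

lemma l1_ft_trivial_nonneg:
  assumes "f \<in> l1_space G" and "\<And>x. 0 \<le> f x"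
  shows "l1_ft G (\<lambda>_. 1) f = of_real (l1_norm G f)"
  using has_sum_l1_norm[OF assms] by (simp add: l1_ft_def infsumI has_sum_of_real)

text \<open>When \<open>f\<close> is not summable, neither is its complex image, and both infinite
  sums take the default value \<open>0\<close>.\<close>

lemma infsum_complex_of_real: "(\<Sum>\<^sub>\<infinity>x\<in>A. complex_of_real (f x)) = of_real (infsum f A)"
proof (cases "f summable_on A")
  case True
  then show ?thesis by (intro infsumI has_sum_of_real has_sum_infsum)
next
  case False
  then have "\<not> (\<lambda>x. complex_of_real (f x)) summable_on A"
    using summable_on_Re by fastforce
  with False show ?thesis by (simp add: infsum_not_exists)
qed

text \<open>The change of variables \<open>x = y z\<close> that turns the double sum of a
  convolution into a product of two sums.\<close>

lemma (in group) bij_betw_shear: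
  "bij_betw (\<lambda>(y, z). (y \<otimes> z, y)) (carrier G \<times> carrier G) (carrier G \<times> carrier G)"
  by (rule bij_betwI[where g = "\<lambda>(x, y). (y, inv y \<otimes> x)"])
    (auto simp: m_assoc[symmetric])

text \<open>Fubini for the kernel \<open>K\<close>, whose absolute summability comes from that of
  \<open>F y * H z\<close> through the shear. The case \<open>\<psi> = 1\<close> yields closure of
  the space under convolution.\<close>

lemma (in group)
  assumes f: "f \<in> l1_space G" and g: "g \<in> l1_space G"
    and \<psi>: "\<And>x. x \<in> carrier G \<Longrightarrow> norm (\<psi> x) \<le> 1"
    and mult: "\<And>x y. x \<in> carrier G \<Longrightarrow> y \<in> carrier G \<Longrightarrow> \<psi> (x \<otimes> y) = \<psi> x * \<psi> y"
  shows l1_conv_ft_abs_summable: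
      "(\<lambda>x. complex_of_real (l1_conv G f g x) * \<psi> x) abs_summable_on carrier G" (is ?A)
    and l1_ft_conv: "l1_ft G \<psi> (l1_conv G f g) = l1_ft G \<psi> f * l1_ft G \<psi> g" (is ?B)
proof -
  let ?C = "carrier G"
  define F where "F x = complex_of_real (f x) * \<psi> x" for x
  define H where "H x = complex_of_real (g x) * \<psi> x" for x
  define K where "K = (\<lambda>(x, y). complex_of_real (f y * g (inv y \<otimes> x)) * \<psi> x)"
  have F: "F abs_summable_on ?C" and H: "H abs_summable_on ?C"
    unfolding F_def H_def by (intro l1_ft_abs_summable f g \<psi>; assumption)+
  have K_shear: "K (y \<otimes> z, y) = F y * H z" if "y \<in> ?C" "z \<in> ?C" for y z
    using that by (simp add: K_def F_def H_def mult m_assoc[symmetric])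
  have FH: "(\<lambda>(y, z). F y * H z) abs_summable_on ?C \<times> ?C"
    unfolding Infinite_Sum.abs_summable_on_Sigma_iff
    using F H by (auto simp: norm_mult infsum_cmult_right' abs_mult infsum_nonneg
        intro!: summable_on_cmult_right summable_on_cmult_left)
  then have "(\<lambda>p. norm (K (case p of (y, z) \<Rightarrow> (y \<otimes> z, y)))) summable_on ?C \<times> ?C"
    by (rule summable_on_cong[THEN iffD1, rotated]) (auto simp: K_shear)
  then have K: "K abs_summable_on ?C \<times> ?C"
    by (simp only: summable_on_reindex_bij_betw[OF bij_betw_shear, of "\<lambda>p. norm (K p)"])
  have inner: "complex_of_real (l1_conv G f g x) * \<psi> x = (\<Sum>\<^sub>\<infinity>y\<in>?C. K (x, y))" if "x \<in> ?C" for x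
  proof -
    have "(\<Sum>\<^sub>\<infinity>y\<in>?C. complex_of_real (f y * g (inv y \<otimes> x))) = of_real (\<Sum>\<^sub>\<infinity>y\<in>?C. f y * g (inv y \<otimes> x))"
      by (rule infsum_complex_of_real)
    then show ?thesis using that
      by (simp add: K_def l1_conv_def infsum_cmult_left')
  qed
  have K1: "(\<lambda>y. K (x, y)) abs_summable_on ?C" if "x \<in> ?C" for x
    using K that unfolding Infinite_Sum.abs_summable_on_Sigma_iff by blast
  have K2: "(\<lambda>x. \<Sum>\<^sub>\<infinity>y\<in>?C. norm (K (x, y))) summable_on ?C"
    using K unfolding Infinite_Sum.abs_summable_on_Sigma_iff by (simp add: infsum_nonneg)
  show ?A
  proof (rule summable_on_comparison_test[OF K2])
    fix x assume "x \<in> ?C"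
    then show "norm (complex_of_real (l1_conv G f g x) * \<psi> x) \<le> (\<Sum>\<^sub>\<infinity>y\<in>?C. norm (K (x, y)))"
      unfolding inner[OF \<open>x \<in> ?C\<close>] by (intro norm_infsum_bound K1)
  qed simp
  have "l1_ft G \<psi> (l1_conv G f g) = (\<Sum>\<^sub>\<infinity>x\<in>?C. \<Sum>\<^sub>\<infinity>y\<in>?C. K (x, y))"
    unfolding l1_ft_def by (rule infsum_cong) (rule inner)
  also have "\<dots> = infsum K (?C \<times> ?C)"
    by (rule infsum_Sigma_banach) (rule abs_summable_summable[OF K])
  also have "\<dots> = (\<Sum>\<^sub>\<infinity>p\<in>?C \<times> ?C. K (case p of (y, z) \<Rightarrow> (y \<otimes> z, y)))"
    by (rule infsum_reindex_bij_betw[OF bij_betw_shear, symmetric])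
  also have "\<dots> = (\<Sum>\<^sub>\<infinity>(y, z)\<in>?C \<times> ?C. F y * H z)"
    by (rule infsum_cong) (auto simp: K_shear)
  also have "\<dots> = (\<Sum>\<^sub>\<infinity>y\<in>?C. \<Sum>\<^sub>\<infinity>z\<in>?C. F y * H z)"
    using infsum_Sigma_banach[OF abs_summable_summable[OF FH]] by simp
  also have "\<dots> = l1_ft G \<psi> f * l1_ft G \<psi> g"
    by (simp add: infsum_cmult_right' infsum_cmult_left' l1_ft_def F_def H_def)
  finally show ?B .
qed

lemma (in group) l1_conv_in_l1_space:
  assumes "f \<in> l1_space G" and "g \<in> l1_space G"
  shows "l1_conv G f g \<in> l1_space G"
  using l1_conv_ft_abs_summable[OF assms, of "\<lambda>_. 1"]
  by (simp add: l1_space_def l1_conv_def)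

lemma l1_conv_nonneg:
  assumes "\<And>x. 0 \<le> f x" and "\<And>x. 0 \<le> g x"
  shows "0 \<le> l1_conv G f g x"
  using assms by (simp add: l1_conv_def infsum_nonneg)

text \<open>On nonnegative functions the norm is the transform at the trivial character, which is
  multiplicative.\<close>

lemma (in group) l1_norm_conv_nonneg:
  assumes "f \<in> l1_space G" "\<And>x. 0 \<le> f x" and "g \<in> l1_space G" "\<And>x. 0 \<le> g x"
  shows "l1_norm G (l1_conv G f g) = l1_norm G f * l1_norm G g"
proof -
  have "l1_ft G (\<lambda>_. 1) (l1_conv G f g) = l1_ft G (\<lambda>_. 1) f * l1_ft G (\<lambda>_. 1) g"
    by (rule l1_ft_conv[OF assms(1,3)]) auto
  then have "complex_of_real (l1_norm G (l1_conv G f g)) = of_real (l1_norm G f * l1_norm G g)"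
    using assms by (simp add: l1_ft_trivial_nonneg l1_conv_in_l1_space l1_conv_nonneg)
  then show ?thesis by (simp only: of_real_eq_iff)
qed

section \<open>Norm estimates for Haar measures of finite subgroups\<close>

lemma l1_norm_nonneg: "0 \<le> l1_norm G f"
  by (simp add: l1_norm_def infsum_nonneg)

text \<open>Half of the Haar measure of \<open>H\<close>: the rescaled join of the language produces half of the
  positive part of a function.\<close>

definition half_haar :: "'a set \<Rightarrow> 'a \<Rightarrow> real" where
  "half_haar H x = (if x \<in> H then 1 / (2 * card H) else 0)"

lemma half_haar_nonneg: "0 \<le> half_haar H x"
  by (simp add: half_haar_def)

lemma finite_support_l1:
  assumes "finite H" and "H \<subseteq> carrier G" and "\<And>x. x \<notin> H \<Longrightarrow> f x = 0"
  shows "f \<in> l1_space G" and "l1_norm G f = (\<Sum>x\<in>H. \<bar>f x\<bar>)"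
proof -
  have "(\<lambda>x. \<bar>f x\<bar>) summable_on carrier G \<longleftrightarrow> (\<lambda>x. \<bar>f x\<bar>) summable_on H"
    by (rule summable_on_cong_neutral) (use assms in auto)
  then show "f \<in> l1_space G" using assms by (auto simp: l1_space_def)
  have "l1_norm G f = (\<Sum>\<^sub>\<infinity>x\<in>H. \<bar>f x\<bar>)"
    unfolding l1_norm_def by (rule infsum_cong_neutral) (use assms in auto)
  then show "l1_norm G f = (\<Sum>x\<in>H. \<bar>f x\<bar>)" using assms(1) by simp
qed

lemma (in group) half_haar_l1:
  assumes "subgroup H G" and "finite H"
  shows "half_haar H \<in> l1_space G" and "l1_norm G (half_haar H) = 1 / 2"
proof -
  have "H \<noteq> {}" using subgroup.one_closed[OF assms(1)] by auto
  then have "card H > 0" using assms(2) by (simp add: card_gt_0_iff)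
  then have "(\<Sum>x\<in>H. \<bar>half_haar H x\<bar>) = 1 / 2"
    by (simp add: half_haar_def)
  then show "half_haar H \<in> l1_space G" "l1_norm G (half_haar H) = 1 / 2"
    using finite_support_l1[OF assms(2) subgroup.subset[OF assms(1)], of "half_haar H"]
    by (simp_all add: half_haar_def)
qed

text \<open>Only the mass of \<open>P\<close> on \<open>H\<close> is kept: translation by
  \<open>y\<close> in \<open>H\<close> leaves \<open>half_haar H\<close> unchanged, and the
  discarded terms are nonnegative.\<close>

lemma (in group) l1_conv_half_haar_ge:
  assumes H: "subgroup H G" "finite H" and P: "P \<in> l1_space G" "\<And>x. 0 \<le> P x"
  shows "(\<Sum>y\<in>H. P y) * half_haar H x \<le> l1_conv G P (half_haar H) x"
proof (cases "x \<in> H")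
  case True
  have sub: "H \<subseteq> carrier G" by (rule subgroup.subset[OF H(1)])
  have le: "half_haar H z \<le> 1" for z
  proof (cases "z \<in> H")
    case True
    then have "card H > 0" using H(2) by (auto simp: card_gt_0_iff)
    then show ?thesis by (simp add: half_haar_def field_simps)
  qed (simp add: half_haar_def)
  have "(\<lambda>y. P y * half_haar H (inv y \<otimes> x)) summable_on carrier G"
  proof (rule summable_on_comparison_test[OF l1_spaceD[OF P(1)]])
    fix y show "P y * half_haar H (inv y \<otimes> x) \<le> \<bar>P y\<bar>"
      using mult_left_mono[OF le P(2)] P(2)[of y] by simp
  qed (simp add: P(2) half_haar_nonneg)
  then have "(\<Sum>\<^sub>\<infinity>y\<in>H. P y * half_haar H (inv y \<otimes> x)) \<le> (\<Sum>\<^sub>\<infinity>y\<in>carrier G. P y * half_haar H (inv y \<otimes> x))"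
    using H(2) sub by (intro infsum_mono2) (auto simp: P(2) half_haar_nonneg)
  also have "(\<Sum>\<^sub>\<infinity>y\<in>H. P y * half_haar H (inv y \<otimes> x)) = (\<Sum>y\<in>H. P y * half_haar H x)"
    using H(2) True subgroup.m_closed[OF H(1)] subgroup.m_inv_closed[OF H(1)]
    by (simp add: half_haar_def)
  finally show ?thesis using True sub by (auto simp: l1_conv_def sum_distrib_right)
next
  case False
  moreover have "0 \<le> l1_conv G P (half_haar H) x"
    by (intro l1_conv_nonneg P(2) half_haar_nonneg)
  ultimately show ?thesis by (simp add: half_haar_def)
qed

text \<open>Let \<open>Q\<close> be \<open>half_haar H\<close>, \<open>R\<close> its convolution
  with \<open>P\<close>, and \<open>s\<close> the mass of \<open>P\<close> on \<open>H\<close>. From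
  \<open>s Q <= R\<close> and \<open>s <= 1/2\<close> follows
  \<open>|R - Q/2| <= (R - s Q) + (1/2 - s) Q\<close>, which is summed. The bound vanishes when
  \<open>P\<close> has norm \<open>1/2\<close> and all its mass on \<open>H\<close>.\<close>

lemma (in group) l1_dist_conv_half_haar_le:
  assumes H: "subgroup H G" "finite H"
    and P: "P \<in> l1_space G" "\<And>x. 0 \<le> P x" "l1_norm G P \<le> 1 / 2"
  shows "l1_norm G (\<lambda>x. l1_conv G P (half_haar H) x - half_haar H x / 2) \<le>
    l1_norm G P / 2 + 1 / 4 - (\<Sum>x\<in>H. P x)"
proof -
  define Q where "Q = half_haar H"
  define R where "R = l1_conv G P Q"
  define s where "s = (\<Sum>x\<in>H. P x)"
  have Q: "Q \<in> l1_space G" "l1_norm G Q = 1 / 2" "\<And>x. 0 \<le> Q x"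
    unfolding Q_def using half_haar_l1[OF H] half_haar_nonneg by auto
  have R: "R \<in> l1_space G" "l1_norm G R = l1_norm G P / 2" "\<And>x. 0 \<le> R x" "\<And>x. s * Q x \<le> R x"
    unfolding R_def s_def Q_def[symmetric]
    using l1_conv_in_l1_space[OF P(1) Q(1)] l1_norm_conv_nonneg[OF P(1,2) Q(1,3)] Q(2)
      l1_conv_nonneg[OF P(2) Q(3)] l1_conv_half_haar_ge[OF H P(1,2)] by (auto simp: Q_def)
  have "s = (\<Sum>\<^sub>\<infinity>x\<in>H. \<bar>P x\<bar>)" using H(2) P(2) by (simp add: s_def)
  also have "\<dots> \<le> l1_norm G P"
    unfolding l1_norm_def using H(2) subgroup.subset[OF H(1)] l1_spaceD[OF P(1)]
    by (intro infsum_mono2) auto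
  finally have s: "s \<le> 1 / 2" using P(3) by simp
  have Rs: "(R has_sum l1_norm G P / 2) (carrier G)"
    using has_sum_l1_norm[OF R(1,3)] R(2) by simp
  have Qs: "(Q has_sum 1 / 2) (carrier G)"
    using has_sum_l1_norm[OF Q(1,3)] Q(2) by simp
  have bs: "((\<lambda>x. R x + (1 / 2 - 2 * s) * Q x) has_sum (l1_norm G P / 2 + (1 / 2 - 2 * s) * (1 / 2))) (carrier G)"
    by (intro has_sum_add Rs has_sum_cmult_right Qs)
  have "(\<lambda>x. R x - (1 / 2) * Q x) \<in> l1_space G"
    by (intro l1_space_diff R(1) l1_space_cmult Q(1))
  then have "(\<lambda>x. \<bar>R x - Q x / 2\<bar>) summable_on carrier G"
    using l1_spaceD by fastforce
  then have "l1_norm G (\<lambda>x. R x - Q x / 2) \<le> (\<Sum>\<^sub>\<infinity>x\<in>carrier G. R x + (1 / 2 - 2 * s) * Q x)"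
    unfolding l1_norm_def
  proof (rule infsum_mono)
    show "(\<lambda>x. R x + (1 / 2 - 2 * s) * Q x) summable_on carrier G"
      using bs by (auto simp: summable_on_def)
    fix x
    have "s * Q x \<le> Q x / 2" using mult_right_mono[OF s Q(3)[of x]] by simp
    then show "\<bar>R x - Q x / 2\<bar> \<le> R x + (1 / 2 - 2 * s) * Q x"
      using R(4)[of x] by (simp add: algebra_simps abs_le_iff)
  qed
  also have "\<dots> = l1_norm G P / 2 + 1 / 4 - s"
    using infsumI[OF bs] by (simp add: algebra_simps)
  finally show ?thesis unfolding R_def Q_def s_def .
qed

text \<open>All functions carry a factor \<open>1/2\<close>, so almost idempotence forces the
  transform \<open>F\<close> of \<open>Q\<close> to stay near \<open>0\<close> or
  \<open>1/2\<close>. The constant \<open>1/16\<close> is the least value of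
  \<open>|z| |z - 1/2|\<close> on the circle \<open>|z| = 1/4\<close>, which separates the
  two.\<close>

lemma (in group) almost_invariant_idempotent_lower_bound:
  fixes \<tau> :: "'a \<Rightarrow> real"
  assumes hom: "\<And>x y. x \<in> carrier G \<Longrightarrow> y \<in> carrier G \<Longrightarrow> \<tau> (x \<otimes> y) = \<tau> x + \<tau> y"
    and a: "a \<in> carrier G" "\<tau> a \<noteq> 0"
    and Q: "Q \<in> l1_space G" "\<And>x. 0 \<le> Q x" and Q_le: "l1_norm G Q \<le> 1 / 2"
    and P: "P = (\<lambda>x. if x = a then 1 / 2 else 0)"
  shows "1 / 16 \<le> l1_norm G (\<lambda>x. l1_conv G Q Q x - Q x / 2) +
    l1_norm G (\<lambda>x. l1_conv G P Q x - Q x / 2) + 1 / 2 - l1_norm G Q"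
proof (rule ccontr)
  assume neg: "\<not> ?thesis"
  define \<psi> where "\<psi> t x = cis (t * \<tau> x)" for t x
  define F where "F t = l1_ft G (\<psi> t) Q" for t
  define d where "d = l1_norm G (\<lambda>x. l1_conv G Q Q x - Q x / 2)"
  define d' where "d' = l1_norm G (\<lambda>x. l1_conv G P Q x - Q x / 2)"
  have \<psi>1: "norm (\<psi> t x) \<le> 1" for t x by (simp add: \<psi>_def)
  have \<psi>m: "\<psi> t (x \<otimes> y) = \<psi> t x * \<psi> t y" if "x \<in> carrier G" "y \<in> carrier G" for t x y
    by (simp add: \<psi>_def hom[OF that] distrib_left cis_mult)
  have Pl: "P \<in> l1_space G"
    by (rule finite_support_l1(1)[of "{a}"]) (use a P in auto)
  have Pft: "l1_ft G (\<psi> t) P = \<psi> t a / 2" for t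
  proof -
    have "l1_ft G (\<psi> t) P = (\<Sum>\<^sub>\<infinity>x\<in>{a}. of_real (P x) * \<psi> t x)"
      unfolding l1_ft_def by (rule infsum_cong_neutral) (use a P in auto)
    then show ?thesis by (simp add: P)
  qed
  have half: "(\<lambda>x. Q x / 2) \<in> l1_space G" "l1_ft G \<psi>' (\<lambda>x. Q x / 2) = l1_ft G \<psi>' Q / 2" for \<psi>'
    using l1_space_cmult[OF Q(1), of "1 / 2"] l1_ft_cmult[of G \<psi>' "1 / 2" Q] by simp_all
  have est: "norm (l1_ft G (\<psi> t) R * F t - F t / 2) \<le> l1_norm G (\<lambda>x. l1_conv G R Q x - Q x / 2)"
    if "R \<in> l1_space G" for R t
  proof -
    have "l1_ft G (\<psi> t) (l1_conv G R Q) = l1_ft G (\<psi> t) R * F t"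
      unfolding F_def by (rule l1_ft_conv[OF that Q(1)]) (use \<psi>1 \<psi>m in auto)
    then have "l1_ft G (\<psi> t) R * F t - F t / 2 = l1_ft G (\<psi> t) (\<lambda>x. l1_conv G R Q x - Q x / 2)"
      unfolding F_def l1_ft_diff[OF l1_conv_in_l1_space[OF that Q(1)] half(1) \<psi>1] half(2) by simp
    then show ?thesis
      using norm_l1_ft_le[OF l1_space_diff[OF l1_conv_in_l1_space[OF that Q(1)] half(1)] \<psi>1]
      by simp
  qed
  have F0: "F 0 = of_real (l1_norm G Q)"
    using l1_ft_trivial_nonneg[OF Q] by (simp add: F_def \<psi>_def[abs_def])
  \<comment> \<open>The contributions \<open>d\<close>, \<open>d'\<close> and
    \<open>1/2 - l1_norm G Q\<close> are nonnegative, so each of them is below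
    \<open>1/16\<close>.\<close>
  have small: "d < 1 / 16" "d' < 1 / 16" "l1_norm G Q > 7 / 16"
    using neg Q_le l1_norm_nonneg[of G "\<lambda>x. l1_conv G Q Q x - Q x / 2"]
      l1_norm_nonneg[of G "\<lambda>x. l1_conv G P Q x - Q x / 2"]
    unfolding d_def[symmetric] d'_def[symmetric] by linarith+
  have "continuous_on UNIV F"
  proof -
    \<comment> \<open>The terms are dominated by \<open>|Q x|\<close> uniformly in
      \<open>t\<close>.\<close>
    have "uniform_limit UNIV (\<lambda>X t. \<Sum>x\<in>X. of_real (Q x) * \<psi> t x) F (finite_subsets_at_top (carrier G))"
      unfolding F_def l1_ft_def
    proof (rule Weierstrass_m_test_general)
      show "(\<lambda>x. \<bar>Q x\<bar>) summable_on carrier G" by (rule l1_spaceD[OF Q(1)])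
    qed (simp add: norm_mult \<psi>_def)
    then show ?thesis
      by (rule uniform_limit_theorem[rotated])
        (auto simp: \<psi>_def cis_conv_exp intro!: always_eventually continuous_intros)
  qed
  then have cont: "continuous_on UNIV (\<lambda>t. norm (F t))" by (rule continuous_on_norm)
  \<comment> \<open>At this frequency the transform of \<open>P\<close> is \<open>-1/2\<close>, so
    almost invariance reads \<open>norm (F t1) <= d'\<close>.\<close>
  define t1 where "t1 = pi / \<tau> a"
  have "\<psi> t1 a = -1" using a by (simp add: \<psi>_def t1_def)
  then have "l1_ft G (\<psi> t1) P * F t1 - F t1 / 2 = - F t1"
    by (simp add: Pft field_simps)
  then have "norm (F t1) \<le> d'"
    using est[OF Pl, of t1] by (simp add: d'_def)
  then have "norm (F t1) \<le> 1 / 4" "1 / 4 \<le> norm (F 0)" using small by (simp_all add: F0)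
  \<comment> \<open>The intermediate value theorem, by connectedness of the line: the norm of
    \<open>F\<close> must cross the gap.\<close>
  then have "1 / 4 \<in> range (\<lambda>t. norm (F t))"
    using connectedD_interval[OF connected_continuous_image[OF cont connected_UNIV],
      of "norm (F t1)" "norm (F 0)" "1 / 4"] by blast
  then obtain t where t: "norm (F t) = 1 / 4" by force
  have "norm (F t * F t - F t / 2) = norm (F t) * norm (F t - 1 / 2)"
    by (simp add: algebra_simps flip: norm_mult)
  moreover have "norm (F t - 1 / 2) \<ge> 1 / 4"
    using norm_triangle_ineq2[of "1 / 2" "F t"] t by (simp add: norm_minus_commute norm_divide)
  ultimately have "1 / 16 \<le> norm (F t * F t - F t / 2)" using t by simp
  also have "\<dots> \<le> d" using est[OF Q(1), of t] by (simp add: F_def d_def)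
  finally show False using small(1) by simp
qed

section \<open>The separating sentence\<close>

text \<open>Quantifiers range over the whole unit ball. Positive parts turn each element into a
  nonnegative function of norm at most \<open>1/2\<close>, so the sentence in effect quantifies over
  measures.\<close>

definition half_pos :: "('a \<Rightarrow> real) \<Rightarrow> 'a \<Rightarrow> real" where
  "half_pos f x = max (f x) 0 / 2"

text \<open>With \<open>p' = 2 * half_pos p\<close> and \<open>f' = 2 * half_pos f\<close>, the first two summands are a quarter of
  the norms of \<open>p' * p' - p'\<close> and \<open>f' * p' - p'\<close>; the rest is half of the norm that \<open>p'\<close> lacks to be
  a probability measure, minus a quarter of the norm that \<open>f'\<close> lacks.\<close>

definition invariance_defect :: "('a, 'b) monoid_scheme \<Rightarrow> ('a \<Rightarrow> real) \<Rightarrow> ('a \<Rightarrow> real) \<Rightarrow> real" where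
  "invariance_defect G f p =
     l1_norm G (\<lambda>x. l1_conv G (half_pos p) (half_pos p) x - half_pos p x / 2) +
     l1_norm G (\<lambda>x. l1_conv G (half_pos f) (half_pos p) x - half_pos p x / 2) -
     l1_norm G (half_pos p) + l1_norm G (half_pos f) / 2 + 1 / 4"

abbreviation half_pos_tm :: "nat \<Rightarrow> cnv_tm" where
  "half_pos_tm n \<equiv> CJoin (CVar n) CZero"

text \<open>\<open>CAdd\<close> with \<open>CZero\<close> halves a function, which matches the
  factor \<open>1/4\<close> in the convolution of two halved functions. Variable \<open>0\<close>
  stands for \<open>f\<close>, variable \<open>1\<close> for \<open>p\<close>.\<close>

definition torsion_sentence :: cnv_fm where
  "torsion_sentence = CSup 0 (CInf 1 (CConn (\<lambda>v. v 0 + v 1 - v 2 + v 3 / 2 + 1 / 4)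
     [CDist (CConv (half_pos_tm 1) (half_pos_tm 1)) (CAdd (half_pos_tm 1) CZero),
      CDist (CConv (half_pos_tm 0) (half_pos_tm 1)) (CAdd (half_pos_tm 1) CZero),
      CNorm (half_pos_tm 1),
      CNorm (half_pos_tm 0)]))"

lemma torsion_sentence_wf: "cnv_wf torsion_sentence" "cnv_fm_vars torsion_sentence = {}"
proof -
  have proj: "continuous_map (product_topology (\<lambda>_. euclidean) {..<4}) euclidean (\<lambda>v. v i :: real)"
    if "i < 4" for i :: nat
    using that by (intro continuous_map_product_projection) auto
  have "continuous_map (product_topology (\<lambda>_. euclidean) {..<4::nat}) euclidean
      (\<lambda>v. v 0 + v 1 - v 2 + v 3 / 2 + 1 / 4 :: real)"
    by (intro continuous_map_add continuous_map_diff continuous_map_real_divide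
        continuous_map_const[THEN iffD2] proj) auto
  then show "cnv_wf torsion_sentence"
    by (simp add: torsion_sentence_def numeral_eq_Suc)
  show "cnv_fm_vars torsion_sentence = {}" by (auto simp: torsion_sentence_def)
qed

definition l1_ball :: "('a, 'b) monoid_scheme \<Rightarrow> ('a \<Rightarrow> real) set" where
  "l1_ball G = {f \<in> l1_space G. l1_norm G f \<le> 1}"

lemma torsion_sentence_val:
  "cnv_val (l1_alg G) e torsion_sentence = (SUP f\<in>l1_ball G. INF p\<in>l1_ball G. invariance_defect G f p)"
  by (simp add: torsion_sentence_def l1_alg_def l1_ball_def invariance_defect_def half_pos_def[abs_def]
      numeral_eq_Suc)

section \<open>Bounds that make the infima and the supremum meaningful\<close>

lemma half_pos_l1:
  assumes "f \<in> l1_ball G"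
  shows "half_pos f \<in> l1_space G" and "l1_norm G (half_pos f) \<le> 1 / 2"
proof -
  have f: "f \<in> l1_space G" "l1_norm G f \<le> 1" using assms by (auto simp: l1_ball_def)
  have half: "(\<lambda>x. (1 / 2) * \<bar>f x\<bar>) summable_on carrier G"
    by (intro summable_on_cmult_right l1_spaceD f)
  have le: "\<bar>half_pos f x\<bar> \<le> (1 / 2) * \<bar>f x\<bar>" for x by (simp add: half_pos_def)
  have sum: "(\<lambda>x. \<bar>half_pos f x\<bar>) summable_on carrier G"
    by (rule summable_on_comparison_test[OF half le]) simp
  moreover have "\<forall>x. x \<notin> carrier G \<longrightarrow> half_pos f x = 0"
    using f(1) by (simp add: l1_space_def half_pos_def)
  ultimately show "half_pos f \<in> l1_space G" unfolding l1_space_def by blast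
  have "l1_norm G (half_pos f) \<le> (\<Sum>\<^sub>\<infinity>x\<in>carrier G. (1 / 2) * \<bar>f x\<bar>)"
    unfolding l1_norm_def by (rule infsum_mono[OF sum half le])
  also have "\<dots> = (1 / 2) * l1_norm G f" unfolding l1_norm_def by (rule infsum_cmult_right')
  finally show "l1_norm G (half_pos f) \<le> 1 / 2" using f(2) by simp
qed

lemma half_pos_nonneg: "0 \<le> half_pos f x"
  by (simp add: half_pos_def)

lemma zero_in_l1_ball: "(\<lambda>_. 0) \<in> l1_ball G"
  by (simp add: l1_ball_def l1_space_def l1_norm_def)

lemma invariance_defect_lower: "p \<in> l1_ball G \<Longrightarrow> - 1 / 4 \<le> invariance_defect G f p"
  using half_pos_l1(2)[of p G] l1_norm_nonneg[of G "half_pos f"]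
    l1_norm_nonneg[of G "\<lambda>x. l1_conv G (half_pos p) (half_pos p) x - half_pos p x / 2"]
    l1_norm_nonneg[of G "\<lambda>x. l1_conv G (half_pos f) (half_pos p) x - half_pos p x / 2"]
  unfolding invariance_defect_def by linarith

lemma bdd_below_invariance_defect: "bdd_below (invariance_defect G f ` l1_ball G)"
  using invariance_defect_lower by (auto intro!: bdd_belowI2)

text \<open>The choice \<open>p = 0\<close> bounds every inner infimum, so that the outer supremum
  is taken over a set bounded above.\<close>

lemma invariance_defect_zero_le:
  assumes "f \<in> l1_ball G"
  shows "invariance_defect G f (\<lambda>_. 0) \<le> 1 / 2"
proof -
  have [simp]: "half_pos (\<lambda>_. 0) = (\<lambda>_. 0)" by (simp add: half_pos_def[abs_def])
  have [simp]: "l1_conv G g (\<lambda>_. 0) = (\<lambda>_. 0)" for g :: "'a \<Rightarrow> real"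
    by (rule ext) (simp add: l1_conv_def infsum_0)
  have [simp]: "l1_norm G (\<lambda>_. 0) = 0" by (simp add: l1_norm_def)
  show ?thesis using half_pos_l1(2)[OF assms] by (simp add: invariance_defect_def)
qed

text \<open>Let \<open>H\<close> be a finite subgroup carrying all but \<open>\<delta>\<close> of
  the mass of \<open>P\<close>. For its Haar measure the idempotence term is \<open>0\<close>, and
  the other terms add up to at most the norm of \<open>P\<close> minus its mass on
  \<open>H\<close>.\<close>

lemma (in group) torsion_sentence_locally_finite:
  assumes fin: "\<And>S. finite S \<Longrightarrow> S \<subseteq> carrier G \<Longrightarrow> \<exists>H. subgroup H G \<and> finite H \<and> S \<subseteq> H"
  shows "cnv_val (l1_alg G) e torsion_sentence \<le> 0"
  unfolding torsion_sentence_val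
proof (rule cSUP_least)
  show "l1_ball G \<noteq> {}" using zero_in_l1_ball by blast
  fix f assume "f \<in> l1_ball G"
  define P where "P = half_pos f"
  have P: "P \<in> l1_space G" "\<And>x. 0 \<le> P x" "l1_norm G P \<le> 1 / 2"
    unfolding P_def using half_pos_l1[OF \<open>f \<in> l1_ball G\<close>] half_pos_nonneg by auto
  show "(INF p\<in>l1_ball G. invariance_defect G f p) \<le> 0"
  proof (rule field_le_epsilon)
    fix \<delta> :: real assume "0 < \<delta>"
    then obtain S where S: "finite S" "S \<subseteq> carrier G" "dist (sum P S) (l1_norm G P) \<le> \<delta>"
      using has_sum_finite_approximation[OF has_sum_l1_norm[OF P(1,2)]] by blast
    obtain H where H: "subgroup H G" "finite H" "S \<subseteq> H" using fin[OF S(1,2)] by blast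
    have "sum P S \<le> sum P H" using H P(2) by (intro sum_mono2) auto
    then have sH: "l1_norm G P - \<delta> \<le> sum P H" using S(3) by (simp add: dist_real_def)
    define p where "p x = 2 * half_haar H x" for x
    have Q: "half_haar H \<in> l1_space G" "l1_norm G (half_haar H) = 1 / 2"
      by (rule half_haar_l1[OF H(1,2)])+
    have hp: "half_pos p = half_haar H"
      by (simp add: half_pos_def[abs_def] p_def half_haar_nonneg max_absorb1)
    have "l1_norm G p = (\<Sum>\<^sub>\<infinity>x\<in>carrier G. 2 * \<bar>half_haar H x\<bar>)"
      unfolding l1_norm_def p_def abs_mult by simp
    also have "\<dots> = 2 * l1_norm G (half_haar H)"
      unfolding l1_norm_def by (rule infsum_cmult_right')
    finally have "p \<in> l1_ball G"
      using l1_space_cmult[OF Q(1), of 2] Q(2) by (simp add: l1_ball_def p_def[abs_def])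
    moreover have "invariance_defect G f p \<le> \<delta>"
    proof -
      have "l1_norm G (\<lambda>x. l1_conv G (half_haar H) (half_haar H) x - half_haar H x / 2) \<le>
          l1_norm G (half_haar H) / 2 + 1 / 4 - (\<Sum>x\<in>H. half_haar H x)"
        using l1_dist_conv_half_haar_le[OF H(1,2) Q(1) half_haar_nonneg] Q(2) by simp
      moreover have "(\<Sum>x\<in>H. half_haar H x) = 1 / 2"
      proof -
        have "l1_norm G (half_haar H) = (\<Sum>x\<in>H. \<bar>half_haar H x\<bar>)"
          by (rule finite_support_l1(2)[OF H(2) subgroup.subset[OF H(1)]])
            (simp add: half_haar_def)
        then show ?thesis using Q(2) by (simp add: half_haar_nonneg)
      qed
      moreover note l1_dist_conv_half_haar_le[OF H(1,2) P]
      ultimately show ?thesis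
        using Q(2) sH unfolding invariance_defect_def hp P_def[symmetric] by simp
    qed
    ultimately show "(INF p\<in>l1_ball G. invariance_defect G f p) \<le> 0 + \<delta>"
      by (auto intro: cINF_lower2[OF bdd_below_invariance_defect])
  qed
qed

text \<open>The test element \<open>f\<close> is the point mass at \<open>a\<close>. Its
  \<open>half_pos\<close> has norm \<open>1/2\<close>, so the defect is exactly the sum bounded in
  \<open>almost_invariant_idempotent_lower_bound\<close>.\<close>

lemma (in group) torsion_sentence_real_hom:
  fixes \<tau> :: "'a \<Rightarrow> real"
  assumes hom: "\<And>x y. x \<in> carrier G \<Longrightarrow> y \<in> carrier G \<Longrightarrow> \<tau> (x \<otimes> y) = \<tau> x + \<tau> y"
    and a: "a \<in> carrier G" "\<tau> a \<noteq> 0"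
  shows "1 / 16 \<le> cnv_val (l1_alg G) e torsion_sentence"
proof -
  define f :: "'a \<Rightarrow> real" where "f x = (if x = a then 1 else 0)" for x
  define P :: "'a \<Rightarrow> real" where "P = (\<lambda>x. if x = a then 1 / 2 else 0)"
  have f: "f \<in> l1_ball G"
    using finite_support_l1[of "{a}" G f] a by (simp add: l1_ball_def f_def)
  have hf: "half_pos f = P" by (auto simp: half_pos_def f_def P_def)
  have "l1_norm G P = 1 / 2" using finite_support_l1(2)[of "{a}" G P] a by (simp add: P_def)
  then have "1 / 16 \<le> invariance_defect G f p" if "p \<in> l1_ball G" for p
    using almost_invariant_idempotent_lower_bound[OF hom a half_pos_l1(1)[OF that] half_pos_nonneg
        half_pos_l1(2)[OF that] P_def]
    by (simp add: invariance_defect_def hf)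
  then have "1 / 16 \<le> (INF p\<in>l1_ball G. invariance_defect G f p)"
    using zero_in_l1_ball by (intro cINF_greatest) auto
  also have "\<dots> \<le> (SUP f\<in>l1_ball G. INF p\<in>l1_ball G. invariance_defect G f p)"
  proof (rule cSUP_upper[OF f], rule bdd_aboveI2)
    fix g assume "g \<in> l1_ball G"
    then show "(INF p\<in>l1_ball G. invariance_defect G g p) \<le> 1 / 2"
      using cINF_lower2[OF bdd_below_invariance_defect zero_in_l1_ball] invariance_defect_zero_le
      by blast
  qed
  finally show ?thesis unfolding torsion_sentence_val .
qed

theorem theorem3p27:
  "\<exists>(G\<^sub>1 :: nat monoid) (G\<^sub>2 :: nat monoid).
     group G\<^sub>1 \<and> countable (carrier G\<^sub>1) \<and>
     group G\<^sub>2 \<and> countable (carrier G\<^sub>2) \<and>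
     grp_elem_equiv G\<^sub>1 G\<^sub>2 \<and>
     \<not> cnv_elem_equiv (l1_alg G\<^sub>1) (l1_alg G\<^sub>2)"
proof -
  obtain h1 :: "fracpoly \<Rightarrow> nat" and G1 where G1: "additive_coding h1 G1"
    using ex_additive_coding[OF countable_fracpoly] by blast
  have "countable (UNIV :: (fracpoly \<times> rat) set)"
    unfolding UNIV_Times_UNIV[symmetric] by (intro countable_SIGMA countable_fracpoly) auto
  then obtain h2 :: "fracpoly \<times> rat \<Rightarrow> nat" and G2 where G2: "additive_coding h2 G2"
    using ex_additive_coding by blast
  interpret G1: comm_group G1 using G1 by (rule additive_coding_comm_group)
  interpret G2: comm_group G2 using G2 by (rule additive_coding_comm_group)
  have "grp_elem_equiv G1 G2"
    by (intro grp_elem_equiv_flexible[OF _ _ G1 G2] flexible_prod_rat flexible_fracpoly)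
  moreover have "\<not> cnv_elem_equiv (l1_alg G1) (l1_alg G2)"
  proof
    assume eqv: "cnv_elem_equiv (l1_alg G1) (l1_alg G2)"
    \<comment> \<open>The sentence is closed, but elementary equivalence still asks for assignments
      into the unit ball.\<close>
    let ?e = "\<lambda>_ _. 0 :: real"
    have rng: "range ?e \<subseteq> cnv_univ (l1_alg G)" for G :: "nat monoid"
      using zero_in_l1_ball[of G] by (auto simp: l1_alg_def l1_ball_def)
    have eq: "cnv_val (l1_alg G1) ?e torsion_sentence = cnv_val (l1_alg G2) ?e torsion_sentence"
      by (rule eqv[unfolded cnv_elem_equiv_def, rule_format])
        (intro conjI torsion_sentence_wf rng)+
    have "cnv_val (l1_alg G1) ?e torsion_sentence \<le> 0"
    proof (rule G1.torsion_sentence_locally_finite)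
      fix S assume S: "finite S" "S \<subseteq> carrier G1"
      then obtain T where T: "finite T" "S = h1 ` T"
        using G1 by (auto simp: additive_coding_def dest: finite_subset_image)
      obtain H where H: "finite H" "T \<subseteq> H" "0 \<in> H" "\<And>x y. x \<in> H \<Longrightarrow> y \<in> H \<Longrightarrow> x - y \<in> H"
        using torsion_imp_locally_finite[OF torsion_fracpoly T(1)] by blast
      then show "\<exists>H. subgroup H G1 \<and> finite H \<and> S \<subseteq> H"
        using additive_coding_subgroup[OF G1 H(3,4)] T(2) by (intro exI[of _ "h1 ` H"]) auto
    qed
    moreover have "1 / 16 \<le> cnv_val (l1_alg G2) ?e torsion_sentence"
    proof (rule G2.torsion_sentence_real_hom)
      \<comment> \<open>Decoding followed by projection to the rational factor, which does not
        vanish at \<open>(0, 1)\<close>.\<close>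
      let ?\<tau> = "\<lambda>x. real_of_rat (snd (inv_into UNIV h2 x))"
      have inv: "inv_into UNIV h2 (h2 x) = x" for x
        using G2 by (simp add: additive_coding_def inv_f_f)
      show "?\<tau> (x \<otimes>\<^bsub>G2\<^esub> y) = ?\<tau> x + ?\<tau> y" if "x \<in> carrier G2" "y \<in> carrier G2" for x y
        using that G2 by (auto simp: additive_coding_def inv of_rat_add)
      show "h2 (0, 1) \<in> carrier G2" using G2 by (simp add: additive_coding_def)
      show "?\<tau> (h2 (0, 1)) \<noteq> 0" by (simp add: inv)
    qed
    ultimately show False using eq by simp
  qed
  moreover have "countable (carrier G1)" "countable (carrier G2)" by simp_all
  ultimately show ?thesis using G1.group_axioms G2.group_axioms by blast
qed

end
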